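(* Let $\rho:\Gamma'\to\Gamma$ be an immersion of finite connected core graphs and let $\Lambda:S^1\to\Gamma$ be a primitive immersed loop. Let $\mathbb{S}$ be the union of the circular components of the fibre product $\Gamma'\times_\Gamma S^1$ of $\rho$ and $\Lambda$. Then the number of components of $\mathbb{S}$ is at most the rank of $\Gamma'$.
   Context: An immersion of graphs is a locally injective cellular map. A finite connected graph is core if it has no vertices of valence one. The rank of a connected graph is the rank of its (free) fundamental group. If $f_1:\Gamma_1\to\Gamma$ and $f_2:\Gamma_2\to\Gamma$ are immersions of graphs, the fibre product is $\Gamma_1\times_\Gamma\Gamma_2=\{(x,y)\in\Gamma_1\times\Gamma_2\mid f_1(x)=f_2(y)\}$; it is a graph which immerses into $\Gamma_1$ and $\Gamma_2$ via the coordinate projections. (Here $S^1$ carries the graph structure pulled back from $\Gamma$ via $\Lambda$.) A component is circular if it is homeomorphic to a circle. An immersed loop $\Lambda:S^1\to\Gamma$ is primitive if it does not factor properly through any other immersion $S^1\to\Gamma$, i.e. $\Lambda$ is not the composition of a covering map $S^1\to S^1$ of degree greater than one with an immersion $S^1\to\Gamma$. *)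

theory Defs
  imports
    "Graph_Theory.Bidirected_Digraph"
    "Graph_Theory.Digraph_Component"
    "Graph_Theory.Arc_Walk"
    "HOL-Algebra.Generated_Groups"
    "HOL-Library.Extended_Nat"
begin

text \<open>
  A graph in the sense of Serre and Stallings, i.e. the combinatorial form of a one-dimensional
  cell complex, is a \<^locale>\<open>bidirected_digraph\<close> \<open>G r\<close>: the arcs of \<open>G\<close> are the oriented
  edges, and the fixed-point-free involution \<open>r\<close> of the arcs reverses orientation. A geometric
  edge is thus a pair of mutually reverse arcs; loops and multiple edges are allowed.
\<close>

text \<open>
  Each oriented edge leaving a vertex is one end of an edge at that vertex, so the valence is the
  out-degree and a loop contributes two to it.
\<close>

definition core_graph :: "('v, 'e) pre_digraph \<Rightarrow> ('e \<Rightarrow> 'e) \<Rightarrow> bool" where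
  "core_graph G r \<longleftrightarrow> bidirected_digraph G r \<and> fin_digraph G \<and> connected G \<and>
     (\<forall>v\<in>verts G. out_degree G v \<noteq> 1)"

record ('v, 'e, 'w, 'f) graph_map =
  vmap :: "'v \<Rightarrow> 'w"
  amap :: "'e \<Rightarrow> 'f"

definition graph_hom ::
  "('v, 'e) pre_digraph \<Rightarrow> ('e \<Rightarrow> 'e) \<Rightarrow> ('w, 'f) pre_digraph \<Rightarrow> ('f \<Rightarrow> 'f) \<Rightarrow>
   ('v, 'e, 'w, 'f) graph_map \<Rightarrow> bool" where
  "graph_hom G r H s f \<longleftrightarrow>
     (\<forall>v\<in>verts G. vmap f v \<in> verts H) \<and>
     (\<forall>a\<in>arcs G. amap f a \<in> arcs H \<and>
        tail H (amap f a) = vmap f (tail G a) \<and>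
        head H (amap f a) = vmap f (head G a) \<and>
        amap f (r a) = s (amap f a))"

text \<open>
  On the interior of an edge a graph homomorphism is a homeomorphism, so local injectivity is a
  condition at the vertices only: distinct edge ends at a vertex have distinct images.
\<close>

definition immersion ::
  "('v, 'e) pre_digraph \<Rightarrow> ('e \<Rightarrow> 'e) \<Rightarrow> ('w, 'f) pre_digraph \<Rightarrow> ('f \<Rightarrow> 'f) \<Rightarrow>
   ('v, 'e, 'w, 'f) graph_map \<Rightarrow> bool" where
  "immersion G r H s f \<longleftrightarrow> graph_hom G r H s f \<and>
     (\<forall>v\<in>verts G. inj_on (amap f) (out_arcs G v))"

definition covering_of_degree ::
  "nat \<Rightarrow> ('v, 'e) pre_digraph \<Rightarrow> ('e \<Rightarrow> 'e) \<Rightarrow> ('w, 'f) pre_digraph \<Rightarrow> ('f \<Rightarrow> 'f) \<Rightarrow>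
   ('v, 'e, 'w, 'f) graph_map \<Rightarrow> bool" where
  "covering_of_degree d G r H s f \<longleftrightarrow> graph_hom G r H s f \<and>
     (\<forall>v\<in>verts G. bij_betw (amap f) (out_arcs G v) (out_arcs H (vmap f v))) \<and>
     (\<forall>w\<in>verts H. card {v \<in> verts G. vmap f v = w} = d)"

definition graph_iso ::
  "('v, 'e) pre_digraph \<Rightarrow> ('e \<Rightarrow> 'e) \<Rightarrow> ('w, 'f) pre_digraph \<Rightarrow> ('f \<Rightarrow> 'f) \<Rightarrow>
   ('v, 'e, 'w, 'f) graph_map \<Rightarrow> bool" where
  "graph_iso G r H s f \<longleftrightarrow> graph_hom G r H s f \<and>
     bij_betw (vmap f) (verts G) (verts H) \<and> bij_betw (amap f) (arcs G) (arcs H)"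

text \<open>
  The circle subdivided into \<open>n \<ge> 1\<close> edges. The arcs \<open>(i, True)\<close> and \<open>(i, False)\<close> are the two
  orientations of the edge from \<open>i\<close> to \<open>i + 1\<close> modulo \<open>n\<close>. As in \<^locale>\<open>bidirected_digraph\<close>,
  the reversal maps fix everything that is not an arc.
\<close>

definition circle_graph :: "nat \<Rightarrow> (nat, nat \<times> bool) pre_digraph" where
  "circle_graph n = \<lparr>verts = {..<n}, arcs = {..<n} \<times> UNIV,
     tail = (\<lambda>(i, b). if b then i else Suc i mod n),
     head = (\<lambda>(i, b). if b then Suc i mod n else i)\<rparr>"

definition circle_rev :: "nat \<Rightarrow> nat \<times> bool \<Rightarrow> nat \<times> bool" where
  "circle_rev n = (\<lambda>(i, b). if i < n then (i, \<not> b) else (i, b))"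

text \<open>
  The graph structures on a topological circle are exactly the subdivisions above.
\<close>

definition circular :: "('v, 'e) pre_digraph \<Rightarrow> ('e \<Rightarrow> 'e) \<Rightarrow> bool" where
  "circular G r \<longleftrightarrow> (\<exists>n\<ge>1. \<exists>h. graph_iso (circle_graph n) (circle_rev n) G r h)"

definition primitive_loop ::
  "nat \<Rightarrow> ('v, 'e) pre_digraph \<Rightarrow> ('e \<Rightarrow> 'e) \<Rightarrow> (nat, nat \<times> bool, 'v, 'e) graph_map \<Rightarrow> bool" where
  "primitive_loop n G r f \<longleftrightarrow>
     immersion (circle_graph n) (circle_rev n) G r f \<and>
     \<not> (\<exists>m\<ge>1. \<exists>d>1. \<exists>p g.
         covering_of_degree d (circle_graph n) (circle_rev n) (circle_graph m) (circle_rev m) p \<and>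
         immersion (circle_graph m) (circle_rev m) G r g \<and>
         (\<forall>v\<in>verts (circle_graph n). vmap f v = vmap g (vmap p v)) \<and>
         (\<forall>a\<in>arcs (circle_graph n). amap f a = amap g (amap p a)))"

definition fibre_product ::
  "('v, 'e) pre_digraph \<Rightarrow> ('w, 'f) pre_digraph \<Rightarrow>
   ('v, 'e, 'u, 'g) graph_map \<Rightarrow> ('w, 'f, 'u, 'g) graph_map \<Rightarrow>
   ('v \<times> 'w, 'e \<times> 'f) pre_digraph" where
  "fibre_product G H f g = \<lparr>
     verts = {(x, y). x \<in> verts G \<and> y \<in> verts H \<and> vmap f x = vmap g y},
     arcs = {(a, b). a \<in> arcs G \<and> b \<in> arcs H \<and> amap f a = amap g b},
     tail = (\<lambda>(a, b). (tail G a, tail H b)),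
     head = (\<lambda>(a, b). (head G a, head H b))\<rparr>"

definition fibre_product_rev ::
  "('v, 'e) pre_digraph \<Rightarrow> ('e \<Rightarrow> 'e) \<Rightarrow> ('w, 'f) pre_digraph \<Rightarrow> ('f \<Rightarrow> 'f) \<Rightarrow>
   ('v, 'e, 'u, 'g) graph_map \<Rightarrow> ('w, 'f, 'u, 'g) graph_map \<Rightarrow> 'e \<times> 'f \<Rightarrow> 'e \<times> 'f" where
  "fibre_product_rev G r H s f g =
     (\<lambda>(a, b). if (a, b) \<in> arcs (fibre_product G H f g) then (r a, s b) else (a, b))"

definition components :: "('v, 'e) pre_digraph \<Rightarrow> ('v, 'e) pre_digraph set" where
  "components G = {H. pre_digraph.max_subgraph G connected H}"

definition circular_part :: "('v, 'e) pre_digraph \<Rightarrow> ('e \<Rightarrow> 'e) \<Rightarrow> ('v, 'e) pre_digraph" where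
  "circular_part G r = pre_digraph.Union G {H \<in> components G. circular H r}"

text \<open>
  Based homotopy of closed edge walks is generated by deleting and inserting backtracks.
\<close>

inductive backtrack :: "('v, 'e) pre_digraph \<Rightarrow> ('e \<Rightarrow> 'e) \<Rightarrow> 'v \<Rightarrow> 'e awalk \<Rightarrow> 'e awalk \<Rightarrow> bool"
  for G r v where
  "pre_digraph.awalk G v (p @ [a, r a] @ q) v \<Longrightarrow> backtrack G r v (p @ [a, r a] @ q) (p @ q)"

definition loops :: "('v, 'e) pre_digraph \<Rightarrow> 'v \<Rightarrow> 'e awalk set" where
  "loops G v = {p. pre_digraph.awalk G v p v}"

definition loop_homotopy ::
  "('v, 'e) pre_digraph \<Rightarrow> ('e \<Rightarrow> 'e) \<Rightarrow> 'v \<Rightarrow> ('e awalk \<times> 'e awalk) set" where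
  "loop_homotopy G r v =
     {(p, q). p \<in> loops G v \<and> q \<in> loops G v \<and> equivclp (backtrack G r v) p q}"

definition fundamental_group ::
  "('v, 'e) pre_digraph \<Rightarrow> ('e \<Rightarrow> 'e) \<Rightarrow> 'v \<Rightarrow> 'e awalk set monoid" where
  "fundamental_group G r v = \<lparr>
     carrier = loops G v // loop_homotopy G r v,
     mult = (\<lambda>X Y. loop_homotopy G r v `` {p @ q | p q. p \<in> X \<and> q \<in> Y}),
     one = loop_homotopy G r v `` {[]}\<rparr>"

text \<open>
  The rank of a group is the least number of generators. It is \<open>\<infinity>\<close> if there is no finite
  generating set.
\<close>

definition group_rank :: "('a, 'b) monoid_scheme \<Rightarrow> enat" where
  "group_rank G =
     (INF S\<in>{S. S \<subseteq> carrier G \<and> finite S \<and> generate G S = carrier G}. enat (card S))"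

end

theory Submission
  imports Defs
begin

text \<open>
  The idea is that of stackings, due to Louder and Wilton. Push the loop \<open>\<Lambda>\<close> off itself in the
  extra direction of \<open>\<Gamma> \<times> \<real>\<close>: a stacking is a height function \<open>h\<close> on the vertices of the circle
  such that \<open>(\<Lambda>, h)\<close> is injective on vertices and two edges of the circle with the same image never
  cross, so that the circle becomes embedded. Every primitive loop has a stacking
  (\<open>stacking_exists\<close>). Starting from the constant height, as long as \<open>(\<Lambda>, h)\<close> identifies points, its
  image is a graph in which each vertex has valence at least two. If some vertex has larger valence,
  the first Betti number is at least two, so some integral cocycle vanishes on the loop without being a
  coboundary; its partial sums along the loop break ties in \<open>h\<close> and separate more points
  (\<open>branching_refine\<close>). If all valences are two, the image is a circle, and a reduced loop that
  is not injective winds around it several times (\<open>unbranched_imp_injective\<close>), against primitivity.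

  A stacking pulls back along the projection to the circle: the circular components of the fibre
  product immerse in \<open>\<Gamma>'\<close> and are disjoint in \<open>\<Gamma>' \<times> \<real>\<close>. As each component covers the whole
  circle, it has an edge over the highest and one over the lowest vertex of the circle, hence an edge
  that is topmost and an edge that is lowest among all edges with the same image in \<open>\<Gamma>'\<close>.

  These two properties force the number of circles to be at most \<open>|E| - |V| + 1\<close>, the first Betti
  number of \<open>\<Gamma>'\<close> (\<open>betti_bound_family\<close>). If some circle is topmost everywhere, then its lowest
  edge is the only edge over its image \<open>e\<close>. This closed curve crosses \<open>e\<close> exactly once, so \<open>e\<close>
  does not separate; delete the circle and \<open>e\<close> and use induction. Otherwise the topmost parts
  of the circles are proper arcs, at least one for each circle, with two ends each. Over a vertex of valence \<open>d\<close> of the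
  covered subgraph there are \<open>d\<close> topmost edge ends, of which two belong to the topmost vertex and
  \<open>d - 2\<close> are ends of such arcs. Summing up, the number of arcs is \<open>|E| - |V|\<close> for the covered
  subgraph, and this is at most \<open>|E| - |V|\<close> for \<open>\<Gamma>'\<close>.

  Finally, \<open>|E| - |V| + 1\<close> is a lower bound for the number of generators of the fundamental group:
  each set of edges off a spanning tree defines a homomorphism to \<open>\<int>/2\<close>, counting crossings modulo
  two, and distinct sets give distinct homomorphisms, which are determined by their values on
  generators (\<open>generators_bound\<close>).

  Arcs come in mutually reverse pairs, so the inequalities below are stated in doubled form, with
  \<open>card (arcs G)\<close> in place of \<open>2 |E|\<close>.
\<close>

section \<open>Involutions and spanning forests\<close>

lemma half_of_involution:
  assumes "finite Q" "\<And>a. a \<in> Q \<Longrightarrow> r a \<in> Q" "\<And>a. a \<in> Q \<Longrightarrow> r a \<noteq> a" "\<And>a. a \<in> Q \<Longrightarrow> r (r a) = a"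
  shows "\<exists>H\<subseteq>Q. H \<inter> r ` H = {} \<and> H \<union> r ` H = Q"
  using assms
proof (induction "card Q" arbitrary: Q rule: less_induct)
  case less
  show ?case
  proof (cases "Q = {}")
    case True
    then show ?thesis by (intro exI[of _ "{}"]) simp
  next
    case False
    then obtain a where a: "a \<in> Q" by blast
    let ?Q = "Q - {a, r a}"
    have c: "card ?Q < card Q" using a less.prems(1) by (intro psubset_card_mono) auto
    have st: "r x \<in> ?Q" if "x \<in> ?Q" for x
    proof -
      have x: "x \<in> Q" "x \<noteq> a" "x \<noteq> r a" using that by simp_all
      have "r x \<noteq> a" "r x \<noteq> r a" using less.prems(4)[OF x(1)] less.prems(4)[OF a] x(2,3) by metis+
      then show ?thesis using less.prems(2)[OF x(1)] by simp
    qed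
    have "\<exists>H\<subseteq>?Q. H \<inter> r ` H = {} \<and> H \<union> r ` H = ?Q"
    proof (rule less.hyps[OF c])
      show "finite ?Q" using less.prems(1) by simp
      show "r x \<in> ?Q" if "x \<in> ?Q" for x using st[OF that] .
      show "r x \<noteq> x" if "x \<in> ?Q" for x using less.prems(3)[of x] that by simp
      show "r (r x) = x" if "x \<in> ?Q" for x using less.prems(4)[of x] that by simp
    qed
    then obtain H where H: "H \<subseteq> ?Q" "H \<inter> r ` H = {}" "H \<union> r ` H = ?Q"
      by (elim exE conjE)
    have n: "r a \<notin> H" "a \<notin> r ` H" "a \<noteq> r a" "r a \<notin> r ` H" "a \<notin> H"
      using H less.prems(3)[OF a] by (simp_all add: set_eq_iff) metis+
    with H have "insert a H \<inter> r ` insert a H = {}" by (simp add: image_insert)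
    moreover have "insert a H \<union> r ` insert a H = Q"
    proof -
      have "insert a H \<union> r ` insert a H = {a, r a} \<union> ?Q" unfolding H(3)[symmetric] by auto
      then show ?thesis using a less.prems(2)[OF a] by auto
    qed
    moreover have "insert a H \<subseteq> Q" using H(1) a by auto
    ultimately show ?thesis by (intro exI[of _ "insert a H"] conjI)
  qed
qed
lemma card_half_of_involution:
  assumes "finite Q" "\<And>a. a \<in> Q \<Longrightarrow> r (r a) = a" "H \<subseteq> Q" "H \<inter> r ` H = {}" "H \<union> r ` H = Q"
  shows "card Q = 2 * card H"
proof -
  have "inj_on r H" using assms(2,3) by (metis inj_onI subsetD)
  then have "card (r ` H) = card H" by (rule card_image)
  moreover have "finite H" using assms(1,3) by (rule rev_finite_subset)
  ultimately show ?thesis using card_Un_disjoint[of H "r ` H"] assms(4,5) by simp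
qed

lemma even_card_of_involution:
  assumes "finite Q" "\<And>a. a \<in> Q \<Longrightarrow> r a \<in> Q" "\<And>a. a \<in> Q \<Longrightarrow> r a \<noteq> a" "\<And>a. a \<in> Q \<Longrightarrow> r (r a) = a"
  shows "even (card Q)"
proof -
  obtain H where "H\<subseteq>Q" "H \<inter> r ` H = {}" "H \<union> r ` H = Q"
    using half_of_involution[OF assms] by metis
  then show ?thesis using card_half_of_involution[OF assms(1,4)] by simp
qed

text \<open>
  A spanning forest relative to \<open>U\<close>, grown outwards from \<open>U\<close> one arc at a time. Each arc of \<open>T\<close> has
  a head that was not reached before, which gives the cardinality and shows that \<open>T\<close> contains no arc
  together with its reverse. That \<open>T\<close> connects everything to \<open>U\<close> is expressed by sets \<open>W\<close> in order
  to apply to functions of any type that are constant along \<open>T\<close>. The vertices need not come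
  from a digraph: for stackings they are the vertices of a quotient of the circle.
\<close>

lemma spanning_forest_rel:
  fixes tl hd :: "'b \<Rightarrow> 'v"
  assumes "finite V" "U \<subseteq> V"
    and "\<forall>W. U \<subseteq> W \<and> W \<subset> V \<longrightarrow> (\<exists>a\<in>B. tl a \<in> W \<and> hd a \<in> V - W)"
    and rev: "\<forall>a\<in>B. tl (r a) = hd a \<and> hd (r a) = tl a \<and> r a \<noteq> a"
  shows "\<exists>T\<subseteq>B. finite T \<and> card T = card (V - U) \<and> hd ` T \<inter> U = {} \<and> (\<forall>a\<in>T. r a \<notin> T) \<and>
    (\<forall>W. U \<subseteq> W \<and> (\<forall>a\<in>T. tl a \<in> W \<longleftrightarrow> hd a \<in> W) \<longrightarrow> V \<subseteq> W)"
  using assms(2,3)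
proof (induction "card (V - U)" arbitrary: U)
  case 0
  then have "V = U" using \<open>finite V\<close> by auto
  then show ?case by (intro exI[of _ "{}"]) auto
next
  case (Suc k)
  then have "U \<subset> V" by (metis Diff_cancel card.empty nat.distinct(1) psubsetI)
  with Suc.prems(2) obtain a where a: "a \<in> B" "tl a \<in> U" "hd a \<in> V - U" by auto
  let ?U = "insert (hd a) U"
  have "V - ?U = (V - U) - {hd a}" by auto
  then have k: "k = card (V - ?U)" using Suc.hyps(2) a(3) by simp
  have "\<exists>T\<subseteq>B. finite T \<and> card T = card (V - ?U) \<and> hd ` T \<inter> ?U = {} \<and> (\<forall>a\<in>T. r a \<notin> T) \<and>
    (\<forall>W. ?U \<subseteq> W \<and> (\<forall>a\<in>T. tl a \<in> W \<longleftrightarrow> hd a \<in> W) \<longrightarrow> V \<subseteq> W)"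
  proof (rule Suc.hyps(1)[OF k])
    show "?U \<subseteq> V" using a(3) Suc.prems(1) by simp
    show "\<forall>W. ?U \<subseteq> W \<and> W \<subset> V \<longrightarrow> (\<exists>a\<in>B. tl a \<in> W \<and> hd a \<in> V - W)"
      using Suc.prems(2) by simp
  qed
  then obtain T where T: "T \<subseteq> B" "finite T" "card T = card (V - ?U)" "hd ` T \<inter> ?U = {}" "\<forall>a\<in>T. r a \<notin> T"
    and span: "\<forall>W. ?U \<subseteq> W \<and> (\<forall>a\<in>T. tl a \<in> W \<longleftrightarrow> hd a \<in> W) \<longrightarrow> V \<subseteq> W"
    by (elim exE conjE)
  have "a \<notin> T" "r a \<notin> T" using T(4) rev[rule_format, OF a(1)] a(2) by auto
  have nr: "r b \<noteq> a" if "b \<in> T" for b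
  proof
    assume "r b = a"
    then have "hd b = tl a" using rev that T(1) by auto
    then show False using T(4) that a(2) by auto
  qed
  show ?case
  proof (intro exI[of _ "insert a T"] conjI)
    show "card (insert a T) = card (V - U)" using \<open>a \<notin> T\<close> T(2,3) k Suc.hyps(2) by simp
    show "insert a T \<subseteq> B" "finite (insert a T)" "hd ` insert a T \<inter> U = {}"
      using T(1,2,4) a by auto
    show "\<forall>b\<in>insert a T. r b \<notin> insert a T"
      using \<open>r a \<notin> T\<close> rev[rule_format, OF a(1)] T(5) nr by auto
    show "\<forall>W. U \<subseteq> W \<and> (\<forall>b\<in>insert a T. tl b \<in> W \<longleftrightarrow> hd b \<in> W) \<longrightarrow> V \<subseteq> W"
    proof (intro allI impI, elim conjE)
      fix W assume "U \<subseteq> W" "\<forall>b\<in>insert a T. tl b \<in> W \<longleftrightarrow> hd b \<in> W"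
      then have "?U \<subseteq> W \<and> (\<forall>b\<in>T. tl b \<in> W \<longleftrightarrow> hd b \<in> W)" using a(2) by auto
      then show "V \<subseteq> W" using span by simp
    qed
  qed
qed

section \<open>Counting in a family of stacked circles\<close>

text \<open>
  Connectedness of the spanning subgraph with arc set \<open>A\<close>. The form by cuts makes deleting a
  non-separating edge easy.
\<close>

definition (in bidirected_digraph) connecting :: "'b set \<Rightarrow> bool" where
  "connecting A \<longleftrightarrow> (\<forall>W. W \<noteq> {} \<and> W \<subset> verts G \<longrightarrow> (\<exists>a\<in>A. tail G a \<in> W \<and> head G a \<in> verts G - W))"

lemma (in bidirected_digraph) connecting_arcs:
  assumes "connected G"
  shows "connecting (arcs G)"
  unfolding connecting_def
proof (intro allI impI)
  fix W assume W: "W \<noteq> {} \<and> W \<subset> verts G"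
  then obtain x y where xy: "x \<in> W" "y \<in> verts G - W" by auto
  have "strongly_connected G"
    using assms sym_arcs symmetric_connected_imp_strongly_connected by auto
  then have "x \<rightarrow>\<^sup>*\<^bsub>G\<^esub> y" using xy W by (auto simp: strongly_connected_def)
  show "\<exists>a\<in>arcs G. tail G a \<in> W \<and> head G a \<in> verts G - W"
  proof (rule ccontr)
    assume no: "\<not> ?thesis"
    from \<open>x \<rightarrow>\<^sup>*\<^bsub>G\<^esub> y\<close> have "y \<in> W"
    proof (induction rule: reachable_induct)
      case (step x' y')
      then obtain e where "e \<in> arcs G" "tail G e = x'" "head G e = y'" by auto
      then show ?case using no step.IH by auto
    qed (use xy in auto)
    then show False using xy by simp
  qed
qed

text \<open>
  In a connected graph, \<open>|E| - |V|\<close> does not decrease when passing from a nonempty subgraph \<open>(U, M)\<close>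
  to the whole graph: each vertex outside \<open>U\<close> brings its own edge of a spanning forest relative
  to \<open>U\<close>.
\<close>

lemma (in bidirected_digraph) connected_excess:
  assumes fin: "finite (verts G)" "finite A" and A: "A \<subseteq> arcs G" "arev ` A \<subseteq> A"
    and cut: "connecting A"
    and U: "U \<noteq> {}" "U \<subseteq> verts G"
    and M: "M \<subseteq> A" "tail G ` M \<subseteq> U" "head G ` M \<subseteq> U"
  shows "card M + 2 * card (verts G - U) \<le> card A"
proof -
  have rev: "\<forall>a\<in>A. tail G (arev a) = head G a \<and> head G (arev a) = tail G a \<and> arev a \<noteq> a"
    using A(1) arev_neq by auto
  have cut': "\<forall>W. U \<subseteq> W \<and> W \<subset> verts G \<longrightarrow> (\<exists>a\<in>A. tail G a \<in> W \<and> head G a \<in> verts G - W)"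
    using cut U(1) by (auto simp: connecting_def)
  obtain T where T: "T \<subseteq> A" "finite T" "card T = card (verts G - U)" "head G ` T \<inter> U = {}" "\<forall>a\<in>T. arev a \<notin> T"
    using spanning_forest_rel[OF fin(1) U(2) cut' rev] by (elim exE conjE)
  have "card (arev ` T) = card T" by (rule card_image) blast
  moreover have d1: "T \<inter> arev ` T = {}" using T(5) by auto
  ultimately have "card (T \<union> arev ` T) = 2 * card T" using T(2) by (simp add: card_Un_disjoint)
  moreover have "M \<inter> (T \<union> arev ` T) = {}"
  proof -
    have "a \<notin> M" if "a \<in> T" for a using that T(4) M(3) by auto
    moreover have "arev a \<notin> M" if "a \<in> T" for a
    proof -
      have "a \<in> arcs G" using that T(1) A(1) by auto
      then have "tail G (arev a) \<notin> U" using that T(4) by auto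
      then show ?thesis using M(2) by auto
    qed
    ultimately show ?thesis by auto
  qed
  moreover have "finite M" using M(1) fin(2) by (rule finite_subset)
  ultimately have "card (M \<union> (T \<union> arev ` T)) = card M + 2 * card (verts G - U)"
    using T(2,3) by (simp add: card_Un_disjoint)
  moreover have "card (M \<union> (T \<union> arev ` T)) \<le> card A"
    using M(1) T(1) A(2) by (intro card_mono fin(2)) auto
  ultimately show ?thesis by simp
qed

lemma ex_max_on_finite:
  fixes g :: "'a \<Rightarrow> 'b::linorder"
  assumes "finite F" "F \<noteq> {}"
  obtains m where "m \<in> F" "\<And>x. x \<in> F \<Longrightarrow> g x \<le> g m"
proof -
  have "Max (g ` F) \<in> g ` F" using assms by simp
  then obtain m where "m \<in> F" "Max (g ` F) = g m" by auto
  then show thesis using that assms(1) by (metis Max_ge finite_imageI imageI)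
qed

text \<open>
  Finitely many disjoint circles \<open>S\<close>, immersed in \<open>G\<close> and embedded in \<open>G \<times> \<real>\<close> by the height \<open>h\<close>. The
  circles are the strongly connected components of \<open>S\<close>. The last two assumptions say that every
  circle is somewhere visible from above and somewhere from below.
\<close>

locale stacked_circles = G: bidirected_digraph G r + S: wf_digraph S
  for G :: "('v, 'e) pre_digraph" and r :: "'e \<Rightarrow> 'e" and S :: "('d, 'b) pre_digraph" +
  fixes s :: "'b \<Rightarrow> 'b" and f :: "('d, 'b, 'v, 'e) graph_map" and h :: "'d \<Rightarrow> int"
  assumes fin: "finite (verts G)" "finite (arcs G)" "finite (verts S)" "finite (arcs S)"
    and s_arcs: "b \<in> arcs S \<Longrightarrow> s b \<in> arcs S" and s_s: "b \<in> arcs S \<Longrightarrow> s (s b) = b"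
    and tail_s: "b \<in> arcs S \<Longrightarrow> tail S (s b) = head S b"
    and imm: "immersion S s G r f"
    and two: "x \<in> verts S \<Longrightarrow> out_degree S x = 2"
    and fibre: "x \<in> verts S \<Longrightarrow> y \<in> verts S \<Longrightarrow> vmap f x = vmap f y \<Longrightarrow> h x = h y \<Longrightarrow> x = y"
    and coherent: "b \<in> arcs S \<Longrightarrow> b' \<in> arcs S \<Longrightarrow> amap f b = amap f b' \<Longrightarrow>
      h (tail S b) < h (tail S b') \<Longrightarrow> h (head S b) < h (head S b')"
    and ex_top: "c \<in> S.sccs_verts \<Longrightarrow> \<exists>b\<in>arcs S. tail S b \<in> c \<and>
      (\<forall>b'\<in>arcs S. amap f b' = amap f b \<longrightarrow> h (tail S b') \<le> h (tail S b))"
    and ex_bot: "c \<in> S.sccs_verts \<Longrightarrow> \<exists>b\<in>arcs S. tail S b \<in> c \<and>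
      (\<forall>b'\<in>arcs S. amap f b' = amap f b \<longrightarrow> h (tail S b) \<le> h (tail S b'))"
begin

lemma head_s: "b \<in> arcs S \<Longrightarrow> head S (s b) = tail S b"
  using tail_s[of "s b"] s_arcs[of b] s_s[of b] by simp

lemma amap_in: "b \<in> arcs S \<Longrightarrow> amap f b \<in> arcs G"
  and tail_amap: "b \<in> arcs S \<Longrightarrow> tail G (amap f b) = vmap f (tail S b)"
  and head_amap: "b \<in> arcs S \<Longrightarrow> head G (amap f b) = vmap f (head S b)"
  and amap_s: "b \<in> arcs S \<Longrightarrow> amap f (s b) = r (amap f b)"
  and vmap_in: "x \<in> verts S \<Longrightarrow> vmap f x \<in> verts G"
  using imm by (auto simp: immersion_def graph_hom_def)

lemma locally_inj: "b \<in> arcs S \<Longrightarrow> b' \<in> arcs S \<Longrightarrow> tail S b = tail S b' \<Longrightarrow> amap f b = amap f b' \<Longrightarrow> b = b'"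
  using imm S.tail_in_verts[of b] unfolding immersion_def inj_on_def by (metis in_out_arcs_conv)

lemma s_neq: "b \<in> arcs S \<Longrightarrow> s b \<noteq> b"
  using amap_s[of b] G.arev_neq[OF amap_in[of b]] by auto

lemma same_height_imp_eq:
  assumes "b \<in> arcs S" "b' \<in> arcs S" "amap f b = amap f b'" "h (tail S b) = h (tail S b')"
  shows "b = b'"
  using assms tail_amap[of b] tail_amap[of b'] by (intro locally_inj fibre) auto

lemma sym_S: "symmetric S"
  unfolding symmetric_conv
proof
  fix b assume "b \<in> arcs S"
  then show "\<exists>b'\<in>arcs S. tail S b = head S b' \<and> head S b = tail S b'"
    using s_arcs[of b] tail_s[of b] head_s[of b] by (intro bexI[of _ "s b"]) auto
qed

sublocale S: sym_digraph S by unfold_locales (rule sym_S)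

lemma scc_subset: "c \<in> S.sccs_verts \<Longrightarrow> c \<subseteq> verts S"
  by (rule S.sccs_verts_subsets)

lemma scc_closed:
  assumes "c \<in> S.sccs_verts" "b \<in> arcs S" "tail S b \<in> c"
  shows "head S b \<in> c"
proof -
  have "tail S b \<rightarrow>\<^bsub>S\<^esub> head S b" using assms(2) by (rule S.in_arcs_imp_in_arcs_ends)
  then have "tail S b \<rightarrow>\<^sup>*\<^bsub>S\<^esub> head S b" by simp
  moreover from this have "head S b \<rightarrow>\<^sup>*\<^bsub>S\<^esub> tail S b" by (rule S.symmetric_reachable')
  ultimately show ?thesis using assms(1,3) unfolding S.sccs_verts_def by blast
qed

lemma scc_minimal:
  assumes c: "c \<in> S.sccs_verts" and X: "\<And>b. b \<in> arcs S \<Longrightarrow> tail S b \<in> X \<Longrightarrow> head S b \<in> X"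
    and x: "x \<in> X" "x \<in> c"
  shows "c \<subseteq> X"
proof
  fix y assume "y \<in> c"
  then have "x \<rightarrow>\<^sup>*\<^bsub>S\<^esub> y" using c x unfolding S.sccs_verts_def by blast
  then show "y \<in> X"
    by (induction rule: S.reachable_induct) (use x X in auto)
qed

lemma card_out:
  assumes "X \<subseteq> verts S"
  shows "card {b \<in> arcs S. tail S b \<in> X} = 2 * card X"
proof -
  have "finite X" using assms fin(3) by (rule finite_subset)
  have "{b \<in> arcs S. tail S b \<in> X} = (\<Union>x\<in>X. out_arcs S x)" by auto
  also have "card \<dots> = (\<Sum>x\<in>X. card (out_arcs S x))"
    using \<open>finite X\<close> fin(4) by (intro card_UN_disjoint) (auto simp: out_arcs_def)
  also have "\<dots> = (\<Sum>x\<in>X. 2)" using assms two by (intro sum.cong) (auto simp: out_degree_def)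
  finally show ?thesis by simp
qed

definition strands :: "'d set set \<Rightarrow> 'b set" where
  "strands K = {b \<in> arcs S. tail S b \<in> \<Union>K}"

definition topmost :: "'d set set \<Rightarrow> 'b \<Rightarrow> bool" where
  "topmost K b \<longleftrightarrow> b \<in> strands K \<and> (\<forall>b'\<in>strands K. amap f b' = amap f b \<longrightarrow> h (tail S b') \<le> h (tail S b))"

lemma strands_s: "K \<subseteq> S.sccs_verts \<Longrightarrow> b \<in> strands K \<Longrightarrow> s b \<in> strands K"
  using scc_closed s_arcs tail_s unfolding strands_def by fastforce

lemma finite_strands: "finite (strands K)"
  using fin(4) unfolding strands_def by simp

text \<open>
  Reversing an arc exchanges its ends, and coherence says that the order of two edges with the same
  image is the same at both ends.
\<close>

lemma topmost_s:
  assumes K: "K \<subseteq> S.sccs_verts" and t: "topmost K b"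
  shows "topmost K (s b)"
proof -
  have b: "b \<in> strands K" "b \<in> arcs S" using t by (auto simp: topmost_def strands_def)
  have "h (tail S b') \<le> h (tail S (s b))" if b': "b' \<in> strands K" "amap f b' = amap f (s b)" for b'
  proof (rule ccontr)
    assume less: "\<not> h (tail S b') \<le> h (tail S (s b))"
    have "b' \<in> arcs S" using b'(1) by (simp add: strands_def)
    then have "h (head S (s b)) < h (head S b')"
      using coherent[of "s b" b'] b' less s_arcs[OF b(2)] by auto
    moreover have "amap f (s b') = amap f b" using amap_s \<open>b' \<in> arcs S\<close> b(2) b'(2) by simp
    then have "h (tail S (s b')) \<le> h (tail S b)"
      using t strands_s[OF K b'(1)] unfolding topmost_def by auto
    ultimately show False using tail_s \<open>b' \<in> arcs S\<close> b(2) head_s by simp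
  qed
  then show ?thesis using strands_s[OF K b(1)] unfolding topmost_def by auto
qed

text \<open>
  An edge that a circle crosses exactly once does not separate \<open>G\<close>. If it were the only edge
  between \<open>W\<close> and its complement, the circle would leave \<open>W\<close> exactly once. But the arcs of the circle that
  start in \<open>W\<close> are even in number, two for each vertex, and those that also end in \<open>W\<close> come in
  mutually reverse pairs.
\<close>

lemma cut_without_single:
  assumes c: "c \<in> S.sccs_verts" and b0: "b0 \<in> arcs S" "tail S b0 \<in> c"
    and single: "\<And>b. b \<in> arcs S \<Longrightarrow> tail S b \<in> c \<Longrightarrow> amap f b = amap f b0 \<Longrightarrow> b = b0"
    and A: "amap f ` {b \<in> arcs S. tail S b \<in> c} \<subseteq> A"
    and cut: "\<exists>a\<in>A. tail G a \<in> W \<and> head G a \<in> verts G - W"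
  shows "\<exists>a\<in>A - {amap f b0, r (amap f b0)}. tail G a \<in> W \<and> head G a \<in> verts G - W"
proof (rule ccontr)
  assume no: "\<not> ?thesis"
  define X where "X = {b \<in> arcs S. tail S b \<in> c \<and> vmap f (tail S b) \<in> W}"
  define Y where "Y = {b \<in> X. vmap f (head S b) \<in> W}"
  define Z where "Z = {b \<in> X. vmap f (head S b) \<notin> W}"
  have finX: "finite X" using fin(4) by (simp add: X_def)
  have "{x\<in>c. vmap f x \<in> W} \<subseteq> verts S" using scc_subset[OF c] by auto
  from card_out[OF this] have "even (card X)" by (simp add: X_def)
  moreover have "even (card Y)"
  proof (rule even_card_of_involution[of Y s])
    show "finite Y" using finX by (simp add: Y_def)
    fix b assume b: "b \<in> Y"
    then have "b \<in> arcs S" by (simp add: Y_def X_def)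
    then show "s b \<noteq> b" "s (s b) = b" by (simp_all add: s_neq s_s)
    show "s b \<in> Y" using b scc_closed[OF c] s_arcs tail_s head_s by (auto simp: X_def Y_def)
  qed
  moreover have "card X = card Y + card Z"
  proof -
    have "X = Y \<union> Z" "Y \<inter> Z = {}" by (auto simp: Y_def Z_def)
    moreover have "finite Y" "finite Z" using finX by (simp_all add: Y_def Z_def)
    ultimately show ?thesis by (simp add: card_Un_disjoint)
  qed
  moreover have "card Z = 1"
  proof -
    have Z: "b = b0 \<or> b = s b0" if "b \<in> Z" for b
    proof -
      have b: "b \<in> arcs S" "tail S b \<in> c" "vmap f (tail S b) \<in> W" "vmap f (head S b) \<notin> W"
        using that by (auto simp: Z_def X_def)
      then have "tail G (amap f b) \<in> W" "head G (amap f b) \<in> verts G - W" "amap f b \<in> A"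
        using A by (auto simp: tail_amap head_amap vmap_in)
      then consider "amap f b = amap f b0" | "amap f b = r (amap f b0)" using no by auto
      then show ?thesis
      proof cases
        case 1
        then show ?thesis using single b by simp
      next
        case 2
        then have "s b = b0" using b scc_closed[OF c] by (intro single) (simp_all add: s_arcs tail_s amap_s)
        then show ?thesis using s_s b(1) by auto
      qed
    qed
    obtain a where a: "a \<in> A" "tail G a \<in> W" "head G a \<in> verts G - W" using cut by auto
    then have "a = amap f b0 \<or> a = r (amap f b0)" using no by auto
    then have ends: "vmap f (tail S b0) \<in> W \<longleftrightarrow> vmap f (head S b0) \<notin> W"
      using a b0 G.head_arev[OF amap_in] G.tail_arev[OF amap_in] tail_amap[OF b0(1)] head_amap[OF b0(1)] by auto
    have "head S b0 \<in> c" using scc_closed[OF c b0] .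
    show ?thesis
    proof (cases "vmap f (tail S b0) \<in> W")
      case True
      then have "s b0 \<notin> Z" "b0 \<in> Z" using ends b0 tail_s head_s by (auto simp: Z_def X_def)
      then have "Z = {b0}" using Z by blast
      then show ?thesis by simp
    next
      case False
      then have "b0 \<notin> Z" "s b0 \<in> Z" using ends b0 tail_s head_s s_arcs \<open>head S b0 \<in> c\<close> by (auto simp: Z_def X_def)
      then have "Z = {s b0}" using Z by blast
      then show ?thesis by simp
    qed
  qed
  ultimately show False by simp
qed

text \<open>
  The induction deletes circles and edges at the same time, whence the subfamily \<open>K\<close> and the arc set
  \<open>A\<close>. Visibility from above and below persists in subfamilies.
\<close>

lemma betti_bound_family:
  assumes "K \<subseteq> S.sccs_verts" "A \<subseteq> arcs G" "r ` A \<subseteq> A" "amap f ` strands K \<subseteq> A" "verts G \<noteq> {}"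
    and "G.connecting A"
  shows "2 * card K + 2 * card (verts G) \<le> card A + 2"
  using assms(1-4,6)
proof (induction "card K" arbitrary: K A rule: less_induct)
  case less
  note K = \<open>K \<subseteq> S.sccs_verts\<close> and cut = less.prems(5)
  have finK: "finite K" using K fin(3) by (meson S.sccs_verts_subsets finite_Pow_iff finite_subset Pow_iff subsetI)
  have finA: "finite A" using less.prems(2) fin(2) by (rule finite_subset)
  note excess = G.connected_excess[OF fin(1) finA less.prems(2,3) cut]
  consider "K = {}"
    | c where "c \<in> K" "\<And>b. b \<in> arcs S \<Longrightarrow> tail S b \<in> c \<Longrightarrow> topmost K b"
    | "K \<noteq> {}" "\<And>c. c \<in> K \<Longrightarrow> \<exists>b\<in>arcs S. tail S b \<in> c \<and> \<not> topmost K b"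
    by blast
  then show ?case
  proof cases
    case 1
    obtain x where x: "x \<in> verts G" using \<open>verts G \<noteq> {}\<close> by auto
    have "card ({} :: 'e set) + 2 * card (verts G - {x}) \<le> card A" by (rule excess) (use x in auto)
    moreover have "card (verts G) = Suc (card (verts G - {x}))" by (rule card.remove[OF fin(1) x])
    ultimately show ?thesis using 1 by simp
  next
    case (2 c)
    have c: "c \<in> S.sccs_verts" using 2(1) K by auto
    obtain b0 where b0: "b0 \<in> arcs S" "tail S b0 \<in> c"
      "\<And>b. b \<in> arcs S \<Longrightarrow> amap f b = amap f b0 \<Longrightarrow> h (tail S b0) \<le> h (tail S b)"
      using ex_bot[OF c] by auto
    \<comment> \<open>The arc b0 is both topmost and lowest in its fibre.\<close>
    have single: "b = b0" if "b \<in> strands K" "amap f b = amap f b0" for b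
    proof -
      have "h (tail S b) \<le> h (tail S b0)" using 2(2)[OF b0(1,2)] that unfolding topmost_def by simp
      moreover have "b \<in> arcs S" using that(1) by (simp add: strands_def)
      ultimately show ?thesis using b0(3)[of b] that(2) b0(1) by (intro same_height_imp_eq) auto
    qed
    let ?A = "A - {amap f b0, r (amap f b0)}" and ?K = "K - {c}"
    have b0K: "b0 \<in> strands K" using b0(1,2) 2(1) by (auto simp: strands_def)
    have e: "amap f b0 \<in> A" using b0K less.prems(4) by blast
    have re: "r (amap f b0) \<in> A" using e less.prems(3) by blast
    have ne: "r (amap f b0) \<noteq> amap f b0" using G.arev_neq[OF amap_in[OF b0(1)]] .
    have "card {amap f b0, r (amap f b0)} = 2" using ne by (simp add: card_insert_if)
    moreover have "card ?A = card A - card {amap f b0, r (amap f b0)}"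
      using e re by (intro card_Diff_subset) auto
    moreover have "card {amap f b0, r (amap f b0)} \<le> card A"
      using e re by (intro card_mono finA) auto
    ultimately have cardA: "card A = card ?A + 2" by linarith
    have cardK: "card K = Suc (card ?K)" by (rule card.remove[OF finK 2(1)])
    have "2 * card ?K + 2 * card (verts G) \<le> card ?A + 2"
    proof (rule less.hyps)
      show "card ?K < card K" using cardK by simp
      show "?K \<subseteq> S.sccs_verts" using K by auto
      show "?A \<subseteq> arcs G" using less.prems(2) by auto
      show "r ` ?A \<subseteq> ?A" using less.prems(3) by (auto simp: G.arev_eq_iff) (metis G.arev_arev)
      show "amap f ` strands ?K \<subseteq> ?A"
      proof -
        have "amap f b \<in> ?A" if b: "b \<in> strands ?K" for b
        proof -
          obtain d where d: "b \<in> arcs S" "d \<in> K" "d \<noteq> c" "tail S b \<in> d" using b by (auto simp: strands_def)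
          have bK: "b \<in> strands K" using d by (auto simp: strands_def)
          have "d \<inter> c = {}" using S.sccs_verts_disjoint[of d c] d(2,3) K c by auto
          then have nc: "tail S b \<notin> c" using d(4) by auto
          have "amap f b \<noteq> amap f b0" using single[OF bK] nc b0(2) by auto
          moreover have "amap f b \<noteq> r (amap f b0)"
          proof
            assume "amap f b = r (amap f b0)"
            then have "s b = b0" using amap_s[OF d(1)] by (intro single strands_s K bK) simp
            then have "b = s b0" using s_s[OF d(1)] by auto
            then show False using nc scc_closed[OF c b0(1,2)] tail_s[OF b0(1)] by simp
          qed
          ultimately show ?thesis using bK less.prems(4) by auto
        qed
        then show ?thesis by auto
      qed
      show "G.connecting ?A"
        unfolding G.connecting_def
      proof (intro allI impI cut_without_single[OF c b0(1,2)])
        fix W assume W: "W \<noteq> {} \<and> W \<subset> verts G"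
        show "\<exists>a\<in>A. tail G a \<in> W \<and> head G a \<in> verts G - W"
          using cut W by (simp add: G.connecting_def)
        show "b = b0" if "b \<in> arcs S" "tail S b \<in> c" "amap f b = amap f b0" for b
          using that 2(1) by (intro single) (auto simp: strands_def)
        show "amap f ` {b \<in> arcs S. tail S b \<in> c} \<subseteq> A" using less.prems(4) 2(1) by (auto simp: strands_def)
      qed
    qed
    then show ?thesis using cardA cardK by simp
  next
    case 3
    \<comment> \<open>Topmost arcs and topmost vertices correspond to the arcs and vertices of the covered
      subgraph. The arcs of R c are the ends of the topmost segments of c.\<close>
    define TB where "TB = {b. topmost K b}"
    define TV where "TV = {x \<in> \<Union>K. \<forall>y\<in>\<Union>K. vmap f y = vmap f x \<longrightarrow> h y \<le> h x}"
    define R where "R c = {b \<in> TB. tail S b \<in> c - TV}" for c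
    have UK: "\<Union>K \<subseteq> verts S" using K scc_subset by auto
    have finUK: "finite (\<Union>K)" using UK fin(3) by (rule finite_subset)
    have TBs: "TB \<subseteq> strands K" "TB \<subseteq> arcs S" by (auto simp: TB_def topmost_def strands_def)
    have finTB: "finite TB" using TBs(2) fin(4) by (rule finite_subset)
    have injTB: "inj_on (amap f) TB"
    proof (rule inj_onI)
      fix b b' assume "b \<in> TB" "b' \<in> TB" "amap f b = amap f b'"
      then show "b = b'" using TBs(2) unfolding TB_def topmost_def
        by (intro same_height_imp_eq) (auto simp: strands_def intro: antisym)
    qed
    have imTB: "amap f ` TB = amap f ` strands K"
    proof
      show "amap f ` strands K \<subseteq> amap f ` TB"
      proof
        fix a assume "a \<in> amap f ` strands K"
        then obtain b where b: "b \<in> strands K" "a = amap f b" by auto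
        let ?F = "{b' \<in> strands K. amap f b' = a}"
        have "finite ?F" "?F \<noteq> {}" using finite_strands b by auto
        then obtain m where "m \<in> ?F" "\<And>b'. b' \<in> ?F \<Longrightarrow> h (tail S b') \<le> h (tail S m)"
          by (rule ex_max_on_finite[of ?F "\<lambda>b. h (tail S b)"]) blast
        then have "topmost K m" "amap f m = a" by (auto simp: topmost_def)
        then show "a \<in> amap f ` TB" by (auto simp: TB_def)
      qed
    qed (use TBs in auto)
    have injTV: "inj_on (vmap f) TV"
    proof (rule inj_onI)
      fix x y assume "x \<in> TV" "y \<in> TV" "vmap f x = vmap f y"
      then show "x = y" using UK unfolding TV_def by (intro fibre) (auto intro: antisym)
    qed
    have imTV: "vmap f ` TV = vmap f ` \<Union>K"
    proof
      show "vmap f ` \<Union>K \<subseteq> vmap f ` TV"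
      proof
        fix a assume "a \<in> vmap f ` \<Union>K"
        then obtain b where b: "b \<in> \<Union>K" "a = vmap f b" by blast
        let ?F = "{b' \<in> \<Union>K. vmap f b' = a}"
        have "finite ?F" by (rule finite_subset[OF _ finUK]) blast
        moreover have "?F \<noteq> {}" using b by blast
        ultimately obtain m where "m \<in> ?F" "\<And>b'. b' \<in> ?F \<Longrightarrow> h b' \<le> h m"
          by (rule ex_max_on_finite[of ?F h]) blast
        then have "m \<in> TV" "vmap f m = a" unfolding TV_def by auto
        then show "a \<in> vmap f ` TV" by auto
      qed
    qed (auto simp: TV_def)
    have out_top: "b \<in> TB" if b: "b \<in> arcs S" "tail S b \<in> TV" for b
    proof -
      have "h (tail S b') \<le> h (tail S b)" if b': "b' \<in> strands K" "amap f b' = amap f b" for b'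
      proof -
        have "vmap f (tail S b') = vmap f (tail S b)"
          using b' b(1) tail_amap[of b] tail_amap[of b'] by (simp add: strands_def)
        moreover have "tail S b' \<in> \<Union>K" using b'(1) by (simp add: strands_def)
        ultimately show ?thesis using b(2) unfolding TV_def by blast
      qed
      moreover have "b \<in> strands K" using b unfolding strands_def TV_def by blast
      ultimately show ?thesis by (simp add: TB_def topmost_def)
    qed
    have TVv: "TV \<subseteq> verts S" using UK by (auto simp: TV_def)
    have card_TB: "card TB = 2 * card TV + card (\<Union>c\<in>K. R c)"
    proof -
      let ?D = "{b \<in> arcs S. tail S b \<in> TV}"
      have E: "TB = ?D \<union> (\<Union>c\<in>K. R c)"
        using out_top TBs by (auto simp: R_def strands_def)
      have "?D \<inter> (\<Union>c\<in>K. R c) = {}" by (auto simp: R_def)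
      moreover have "finite (\<Union>c\<in>K. R c)" using finTB by (rule rev_finite_subset) (auto simp: R_def)
      moreover have "finite ?D" using fin(4) by simp
      ultimately have "card TB = card ?D + card (\<Union>c\<in>K. R c)"
        by (subst E) (intro card_Un_disjoint)
      then show ?thesis using card_out[OF TVv] by simp
    qed
    have R2: "2 \<le> card (R c)" if cK: "c \<in> K" for c
    proof -
      have c: "c \<in> S.sccs_verts" using cK K by auto
      have fR: "finite (R c)" using finTB by (simp add: R_def)
      let ?E = "{b \<in> TB. tail S b \<in> c}"
      have "even (card ?E)"
      proof (rule even_card_of_involution[of _ s])
        show "finite ?E" using finTB by simp
        fix b assume b: "b \<in> ?E"
        then have "b \<in> arcs S" using TBs by auto
        then show "s b \<noteq> b" "s (s b) = b" by (simp_all add: s_neq s_s)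
        show "s b \<in> ?E" using b topmost_s[OF K] scc_closed[OF c] tail_s \<open>b \<in> arcs S\<close> by (auto simp: TB_def)
      qed
      moreover have "card ?E = 2 * card (c \<inter> TV) + card (R c)"
      proof -
        let ?D = "{b \<in> arcs S. tail S b \<in> c \<inter> TV}"
        have E: "?E = ?D \<union> R c" using out_top TBs by (auto simp: R_def)
        have "?D \<inter> R c = {}" by (auto simp: R_def)
        moreover have "finite ?D" using fin(4) by simp
        ultimately have "card ?E = card ?D + card (R c)" unfolding E using fR by (intro card_Un_disjoint)
        moreover have "card ?D = 2 * card (c \<inter> TV)" by (rule card_out) (use TVv in auto)
        ultimately show ?thesis by linarith
      qed
      \<comment> \<open>The number of ends is even, so it suffices to find one end in order to have two.\<close>
      ultimately have ev: "even (card (R c))" by simp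
      have "R c \<noteq> {}"
      proof
        assume e: "R c = {}"
        obtain b where b: "b \<in> arcs S" "tail S b \<in> c"
          "\<And>b'. b' \<in> arcs S \<Longrightarrow> amap f b' = amap f b \<Longrightarrow> h (tail S b') \<le> h (tail S b)"
          using ex_top[OF c] by auto
        then have "b \<in> TB" using cK by (auto simp: TB_def topmost_def strands_def)
        then have "tail S b \<in> TV" using e b(2) by (auto simp: R_def)
        \<comment> \<open>Without ends, being a topmost vertex spreads along the whole circle.\<close>
        have "c \<subseteq> c \<inter> TV"
        proof (rule scc_minimal[OF c])
          show "tail S b \<in> c \<inter> TV" "tail S b \<in> c" using \<open>tail S b \<in> TV\<close> b(2) by auto
          fix b' assume b': "b' \<in> arcs S" "tail S b' \<in> c \<inter> TV"
          then have "topmost K (s b')" using out_top[of b'] topmost_s[OF K, of b'] by (simp add: TB_def)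
          moreover have hc: "head S b' \<in> c" using scc_closed[OF c b'(1)] b'(2) by simp
          moreover have "tail S (s b') = head S b'" using tail_s b'(1) by simp
          ultimately have "head S b' \<in> TV" using e unfolding R_def TB_def by (metis (mono_tags, lifting) DiffI empty_iff mem_Collect_eq)
          then show "head S b' \<in> c \<inter> TV" using hc by simp
        qed
        then have "topmost K b" if "b \<in> arcs S" "tail S b \<in> c" for b
          using out_top[of b] that by (auto simp: TB_def)
        then show False using 3(2)[OF cK] by auto
      qed
      then have "card (R c) \<noteq> 0" using fR by simp
      then show ?thesis using ev by presburger
    qed
    have "card (\<Union>c\<in>K. R c) = (\<Sum>c\<in>K. card (R c))"
    proof (intro card_UN_disjoint finK ballI impI)
      fix c d assume "c \<in> K" "d \<in> K" "c \<noteq> d"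
      then have "c \<inter> d = {}" using S.sccs_verts_disjoint[of c d] K by auto
      then show "R c \<inter> R d = {}" by (auto simp: R_def)
    qed (use finTB in \<open>simp add: R_def\<close>)
    moreover have "(\<Sum>c\<in>K. 2) \<le> (\<Sum>c\<in>K. card (R c))" using R2 by (intro sum_mono)
    ultimately have "2 * card K \<le> card (\<Union>c\<in>K. R c)" by simp
    then have TB2: "2 * card TV + 2 * card K \<le> card TB" using card_TB by simp
    let ?U = "vmap f ` \<Union>K" and ?M = "amap f ` strands K"
    have "card ?M + 2 * card (verts G - ?U) \<le> card A"
    proof (rule excess)
      obtain c where "c \<in> K" using 3(1) by auto
      moreover have "c \<noteq> {}" using \<open>c \<in> K\<close> K by (auto simp: S.sccs_verts_def)
      ultimately show "?U \<noteq> {}" by auto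
      show "?U \<subseteq> verts G" using UK vmap_in by auto
      show "?M \<subseteq> A" by (rule less.prems(4))
      show "tail G ` ?M \<subseteq> ?U" by (auto simp: strands_def tail_amap)
      show "head G ` ?M \<subseteq> ?U"
      proof -
        have "head G (amap f b) \<in> ?U" if "b \<in> strands K" for b
          using strands_s[OF K that] that tail_s[of b] head_amap[of b] by (auto simp: strands_def)
        then show ?thesis by auto
      qed
    qed
    moreover have "card ?M = card TB" using card_image[OF injTB] imTB by simp
    moreover have "card ?U = card TV" using card_image[OF injTV] imTV by simp
    moreover have "card (verts G) = card ?U + card (verts G - ?U)"
    proof -
      have "?U \<subseteq> verts G" using UK vmap_in by auto
      then show ?thesis using fin(1) by (metis card_Diff_subset card_mono finite_subset le_add_diff_inverse)
    qed
    ultimately show ?thesis using TB2 by linarith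
  qed
qed

theorem betti_bound:
  assumes "connected G"
  shows "2 * card S.sccs_verts + 2 * card (verts G) \<le> card (arcs G) + 2"
proof (rule betti_bound_family)
  show "verts G \<noteq> {}" using assms by (auto simp: connected_def strongly_connected_def)
  show "amap f ` strands S.sccs_verts \<subseteq> arcs G" using amap_in by (auto simp: strands_def)
  show "G.connecting (arcs G)" using assms by (rule G.connecting_arcs)
qed auto

end

section \<open>Generators of the fundamental group\<close>

context bidirected_digraph
begin

definition inv_walk :: "'b awalk \<Rightarrow> 'b awalk" where
  "inv_walk p = rev (map arev p)"

lemma inv_walk_simps [simp]: "inv_walk [] = []" "inv_walk (p @ q) = inv_walk q @ inv_walk p"
  "inv_walk [a] = [arev a]" "inv_walk (inv_walk p) = p"
  by (simp_all add: inv_walk_def rev_map comp_def)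

lemma awalk_inv_walk: "awalk u p w \<Longrightarrow> awalk w (inv_walk p) u"
proof (induction p arbitrary: u)
  case (Cons a p)
  then have "awalk w (inv_walk p) (head G a)" "a \<in> arcs G" "tail G a = u" by (auto simp: awalk_Cons_iff)
  then show ?case using awalk_append_iff[of w "inv_walk p" "[arev a]" u]
    by (auto simp: inv_walk_def awalk_simps)
qed (auto simp: awalk_simps)

abbreviation homotopic :: "'a \<Rightarrow> 'b awalk \<Rightarrow> 'b awalk \<Rightarrow> bool" where
  "homotopic v \<equiv> equivclp (backtrack G arev v)"

lemma awalk_backtrack:
  "awalk u (p @ [a, arev a] @ q) w \<longleftrightarrow> awalk u (p @ q) w \<and> a \<in> arcs G \<and> awlast u p = tail G a"
proof -
  have "awalk x ([a, arev a] @ q) w \<longleftrightarrow> a \<in> arcs G \<and> x = tail G a \<and> awalk x q w" for x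
    by (cases "a \<in> arcs G") (simp_all add: awalk_Cons_iff, metis)
  then show ?thesis unfolding awalk_append_iff by metis
qed

lemma backtrack_loops:
  assumes "backtrack G arev v p q"
  shows "p \<in> loops G v" "q \<in> loops G v"
proof -
  obtain p1 a q1 where "p = p1 @ [a, arev a] @ q1" "q = p1 @ q1" "awalk v (p1 @ [a, arev a] @ q1) v"
    using assms by (elim backtrack.cases)
  then show "p \<in> loops G v" "q \<in> loops G v"
    unfolding loops_def mem_Collect_eq by (simp_all only: awalk_backtrack)
qed

lemma append_loops: "p \<in> loops G v \<Longrightarrow> q \<in> loops G v \<Longrightarrow> p @ q \<in> loops G v"
  unfolding loops_def mem_Collect_eq by (rule awalk_appendI)

lemma backtrack_append:
  assumes "backtrack G arev v p q" "x \<in> loops G v" "y \<in> loops G v"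
  shows "backtrack G arev v (x @ p @ y) (x @ q @ y)"
  using assms(1)
proof cases
  case (1 p1 a q1)
  have "awalk v ((x @ p1) @ [a, arev a] @ (q1 @ y)) v"
    using append_loops[OF assms(2) append_loops[OF backtrack_loops(1)[OF assms(1)] assms(3)]] 1(1)
    by (simp add: loops_def)
  then have "backtrack G arev v ((x @ p1) @ [a, arev a] @ (q1 @ y)) ((x @ p1) @ (q1 @ y))"
    by (rule backtrack.intros)
  then show ?thesis using 1 by simp
qed

lemma homotopic_append:
  assumes "homotopic v p q" "x \<in> loops G v" "y \<in> loops G v"
  shows "homotopic v (x @ p @ y) (x @ q @ y)"
  using assms(1)
proof (induction rule: equivclp_induct)
  case base
  then show ?case by simp
next
  case (step q r)
  then have "homotopic v (x @ q @ y) (x @ r @ y)"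
    using backtrack_append[OF _ assms(2,3)] equivclp_sym by (metis r_into_equivclp)
  with step show ?case by (metis equivclp_trans)
qed

text \<open>
  The backtracks of \<open>p\<close> followed by its inverse cancel from the middle outwards, so the induction
  removes the last arc of \<open>p\<close>.
\<close>

lemma homotopic_inv_walk: "awalk v p w \<Longrightarrow> homotopic v (p @ inv_walk p) []"
proof (induction p arbitrary: w rule: rev_induct)
  case (snoc a p)
  then have p: "awalk v p (tail G a)" "a \<in> arcs G" by (auto simp: awalk_simps)
  have "awalk v (p @ [a, arev a] @ inv_walk p) v"
    unfolding awalk_backtrack using p awalk_inv_walk[OF p(1)] by auto
  then have "backtrack G arev v (p @ [a, arev a] @ inv_walk p) (p @ inv_walk p)"
    by (rule backtrack.intros)
  then have "homotopic v (p @ [a, arev a] @ inv_walk p) []"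
    using snoc.IH[OF p(1)] by (metis r_into_equivclp equivclp_trans)
  then show ?case by simp
qed simp

definition loop_class :: "'a \<Rightarrow> 'b awalk \<Rightarrow> 'b awalk set" where
  "loop_class v p = loop_homotopy G arev v `` {p}"

lemma equiv_loop_homotopy: "equiv (loops G v) (loop_homotopy G arev v)"
  by (rule equivI) (auto simp: loop_homotopy_def refl_on_def sym_def trans_def
      intro: equivclp_sym equivclp_trans)

lemma loop_class_eq: "p \<in> loops G v \<Longrightarrow> q \<in> loops G v \<Longrightarrow> homotopic v p q \<Longrightarrow> loop_class v p = loop_class v q"
  unfolding loop_class_def using equiv_loop_homotopy by (rule equiv_class_eq) (simp add: loop_homotopy_def)

lemma loop_class_self: "p \<in> loops G v \<Longrightarrow> p \<in> loop_class v p"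
  unfolding loop_class_def using equiv_loop_homotopy by (rule equiv_class_self)

lemma loop_class_loops: "p \<in> loop_class v q \<Longrightarrow> p \<in> loops G v \<and> q \<in> loops G v \<and> homotopic v q p"
  by (simp add: loop_class_def loop_homotopy_def)

lemma carrier_fundamental: "carrier (fundamental_group G arev v) = loop_class v ` loops G v"
  by (auto simp: fundamental_group_def quotient_def loop_class_def)

lemma one_fundamental: "\<one>\<^bsub>fundamental_group G arev v\<^esub> = loop_class v []"
  by (simp add: fundamental_group_def loop_class_def)

lemma mult_fundamental:
  assumes p: "p \<in> loops G v" and q: "q \<in> loops G v"
  shows "loop_class v p \<otimes>\<^bsub>fundamental_group G arev v\<^esub> loop_class v q = loop_class v (p @ q)"
proof -
  have eq: "loop_class v (p' @ q') = loop_class v (p @ q)" if "p' \<in> loop_class v p" "q' \<in> loop_class v q" for p' q'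
  proof -
    note p' = loop_class_loops[OF that(1)] and q' = loop_class_loops[OF that(2)]
    have "[] \<in> loops G v" using p by (auto simp: loops_def awalk_simps)
    then have "homotopic v (p @ q) (p' @ q)" "homotopic v (p' @ q) (p' @ q')"
      using homotopic_append[of v p p' "[]" q] homotopic_append[of v q q' p' "[]"] p' q' by auto
    then have "homotopic v (p' @ q') (p @ q)" by (metis equivclp_trans equivclp_sym)
    then show ?thesis using p' q' by (intro loop_class_eq append_loops) auto
  qed
  have "loop_class v p \<otimes>\<^bsub>fundamental_group G arev v\<^esub> loop_class v q =
    (\<Union>z\<in>{p' @ q' | p' q'. p' \<in> loop_class v p \<and> q' \<in> loop_class v q}. loop_class v z)"
    by (auto simp: fundamental_group_def loop_class_def)
  also have "\<dots> = (\<Union>z\<in>{p' @ q' | p' q'. p' \<in> loop_class v p \<and> q' \<in> loop_class v q}. loop_class v (p @ q))"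
    using eq by (intro SUP_cong refl) auto
  also have "\<dots> = loop_class v (p @ q)" using loop_class_self[OF p] loop_class_self[OF q] by auto
  finally show ?thesis .
qed

lemma inv_walk_loops: "p \<in> loops G v \<Longrightarrow> inv_walk p \<in> loops G v"
  using awalk_inv_walk by (auto simp: loops_def)

lemma loop_class_inv_walk: "p \<in> loops G v \<Longrightarrow> loop_class v (p @ inv_walk p) = loop_class v []"
  using homotopic_inv_walk[of v p v] inv_walk_loops[of p v]
  by (intro loop_class_eq append_loops) (auto simp: loops_def awalk_Nil_iff)

lemma group_fundamental:
  assumes "v \<in> verts G"
  shows "group (fundamental_group G arev v)"
proof (rule groupI)
  let ?F = "fundamental_group G arev v"
  have nil: "[] \<in> loops G v" using assms by (simp add: loops_def awalk_Nil_iff)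
  then show "\<one>\<^bsub>?F\<^esub> \<in> carrier ?F" by (simp add: one_fundamental carrier_fundamental)
  show "x \<otimes>\<^bsub>?F\<^esub> y \<in> carrier ?F" if "x \<in> carrier ?F" "y \<in> carrier ?F" for x y
    using that by (auto simp: carrier_fundamental mult_fundamental append_loops)
  show "x \<otimes>\<^bsub>?F\<^esub> y \<otimes>\<^bsub>?F\<^esub> z = x \<otimes>\<^bsub>?F\<^esub> (y \<otimes>\<^bsub>?F\<^esub> z)"
    if "x \<in> carrier ?F" "y \<in> carrier ?F" "z \<in> carrier ?F" for x y z
    using that by (auto simp: carrier_fundamental mult_fundamental append_loops)
  show "\<one>\<^bsub>?F\<^esub> \<otimes>\<^bsub>?F\<^esub> x = x" if "x \<in> carrier ?F" for x
    using that nil by (auto simp: carrier_fundamental mult_fundamental one_fundamental)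
  show "\<exists>y\<in>carrier ?F. y \<otimes>\<^bsub>?F\<^esub> x = \<one>\<^bsub>?F\<^esub>" if x: "x \<in> carrier ?F" for x
  proof -
    obtain p where p: "p \<in> loops G v" "x = loop_class v p" using x by (auto simp: carrier_fundamental)
    have "loop_class v (inv_walk p) \<otimes>\<^bsub>?F\<^esub> x = \<one>\<^bsub>?F\<^esub>"
      using p inv_walk_loops[OF p(1)] loop_class_inv_walk[OF inv_walk_loops[OF p(1)]]
      by (simp add: mult_fundamental one_fundamental)
    then show ?thesis using inv_walk_loops[OF p(1)] by (auto simp: carrier_fundamental)
  qed
qed

lemma inv_fundamental:
  assumes "p \<in> loops G v"
  shows "inv\<^bsub>fundamental_group G arev v\<^esub> (loop_class v p) = loop_class v (inv_walk p)"
proof -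
  have "v \<in> verts G" using assms by (auto simp: loops_def)
  then interpret F: group "fundamental_group G arev v" by (rule group_fundamental)
  show ?thesis
    using assms inv_walk_loops[OF assms] loop_class_inv_walk[OF inv_walk_loops[OF assms]]
    by (intro F.inv_equality) (auto simp: mult_fundamental one_fundamental carrier_fundamental)
qed

text \<open>
  For a symmetric set \<open>W\<close> of arcs this is a cocycle modulo two; on closed walks it induces a
  homomorphism from the fundamental group to \<open>\<int>/2\<close>.
\<close>

definition crosses_oddly :: "'b set \<Rightarrow> 'b awalk \<Rightarrow> bool" where
  "crosses_oddly W p \<longleftrightarrow> odd (length (filter (\<lambda>a. a \<in> W) p))"

lemma crosses_oddly_simps [simp]:
  "\<not> crosses_oddly W []"
  "crosses_oddly W (p @ q) \<longleftrightarrow> crosses_oddly W p \<noteq> crosses_oddly W q"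
  "crosses_oddly W (a # p) \<longleftrightarrow> (a \<in> W) \<noteq> crosses_oddly W p"
  by (auto simp: crosses_oddly_def)

lemma crosses_oddly_sym_diff:
  "crosses_oddly (W - W' \<union> (W' - W)) p \<longleftrightarrow> crosses_oddly W p \<noteq> crosses_oddly W' p"
  by (induction p) auto

lemma crosses_oddly_inv_walk:
  assumes "\<forall>a. arev a \<in> W \<longleftrightarrow> a \<in> W"
  shows "crosses_oddly W (inv_walk p) \<longleftrightarrow> crosses_oddly W p"
  using assms by (induction p) (auto simp: inv_walk_def)

lemma crosses_oddly_cong:
  assumes W: "\<forall>a. arev a \<in> W \<longleftrightarrow> a \<in> W" and "homotopic v p q"
  shows "crosses_oddly W p \<longleftrightarrow> crosses_oddly W q"
proof -
  have "crosses_oddly W p \<longleftrightarrow> crosses_oddly W q" if "backtrack G arev v p q" for p q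
    using that by (induction rule: backtrack.induct) (use W in auto)
  with assms(2) show ?thesis
    by (induction rule: equivclp_induct) auto
qed

lemma crosses_oddly_generate:
  assumes W: "\<forall>a. arev a \<in> W \<longleftrightarrow> a \<in> W" and v: "v \<in> verts G"
    and S: "S \<subseteq> carrier (fundamental_group G arev v)"
    and even: "\<And>p. p \<in> \<Union>S \<Longrightarrow> \<not> crosses_oddly W p"
    and gen: "X \<in> generate (fundamental_group G arev v) S"
  shows "\<exists>p\<in>loops G v. X = loop_class v p \<and> \<not> crosses_oddly W p"
  using gen
proof (induction rule: generate.induct)
  case one
  show ?case using v by (intro bexI[of _ "[]"]) (auto simp: one_fundamental loops_def awalk_Nil_iff)
next
  case (incl X)
  then obtain p where p: "p \<in> loops G v" "X = loop_class v p" using S by (auto simp: carrier_fundamental)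
  then have "\<not> crosses_oddly W p" using loop_class_self incl even by blast
  then show ?case using p by blast
next
  case (inv X)
  then obtain p where p: "p \<in> loops G v" "X = loop_class v p" using S by (auto simp: carrier_fundamental)
  then have "\<not> crosses_oddly W p" using loop_class_self inv even by blast
  then show ?case using p inv_fundamental inv_walk_loops crosses_oddly_inv_walk[OF W] by blast
next
  case (eng X Y)
  then obtain p q where "p \<in> loops G v" "X = loop_class v p" "\<not> crosses_oddly W p"
    "q \<in> loops G v" "Y = loop_class v q" "\<not> crosses_oddly W q" by blast
  then show ?case by (intro bexI[of _ "p @ q"]) (auto simp: mult_fundamental append_loops)
qed

text \<open>
  A cocycle that vanishes on all loops is the coboundary of its sums along walks from \<open>v\<close>. If it
  also vanishes on a spanning tree, these sums are constant, so the cocycle is zero.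
\<close>

lemma even_on_loops_imp_empty:
  assumes W: "\<forall>a. arev a \<in> W \<longleftrightarrow> a \<in> W" "W \<subseteq> arcs G - T" and con: "strongly_connected G" and v: "v \<in> verts G"
    and span: "\<forall>X. {v} \<subseteq> X \<and> (\<forall>a\<in>T. tail G a \<in> X \<longleftrightarrow> head G a \<in> X) \<longrightarrow> verts G \<subseteq> X"
    and T: "T \<subseteq> arcs G"
    and even: "\<And>p. p \<in> loops G v \<Longrightarrow> \<not> crosses_oddly W p"
  shows "W = {}"
proof -
  have "\<exists>p. awalk v p x" if "x \<in> verts G" for x
    using con v that by (auto simp: strongly_connected_def reachable_awalk)
  then obtain path where path: "\<And>x. x \<in> verts G \<Longrightarrow> awalk v (path x) x" by metis
  have across: "crosses_oddly W (path (tail G a)) \<noteq> crosses_oddly W (path (head G a)) \<longleftrightarrow> a \<in> W"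
    if a: "a \<in> arcs G" for a
  proof -
    have "awalk v (path (tail G a) @ [a] @ inv_walk (path (head G a))) v"
      using a path[of "tail G a"] path[of "head G a"] awalk_inv_walk[of v "path (head G a)" "head G a"]
      by (auto simp: awalk_simps)
    then have "\<not> crosses_oddly W (path (tail G a) @ [a] @ inv_walk (path (head G a)))"
      by (intro even) (simp add: loops_def)
    then show ?thesis using crosses_oddly_inv_walk[OF W(1)] by auto
  qed
  have "path v \<in> loops G v" using path[OF v] by (simp add: loops_def)
  then have "{v} \<subseteq> {x. \<not> crosses_oddly W (path x)}" using even by simp
  moreover have "\<forall>a\<in>T. tail G a \<in> {x. \<not> crosses_oddly W (path x)} \<longleftrightarrow> head G a \<in> {x. \<not> crosses_oddly W (path x)}"
    using across T W(2) by blast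
  ultimately have "verts G \<subseteq> {x. \<not> crosses_oddly W (path x)}" using span by blast
  then have "a \<notin> W" if "a \<in> arcs G" for a
    using across[OF that] tail_in_verts[OF that] head_in_verts[OF that] by blast
  then show "W = {}" using W(2) by blast
qed

text \<open>
  The edges off the spanning tree are oriented by \<open>H\<close>. Each subset of \<open>H\<close> is determined by the set of
  generators that cross it oddly, since the symmetric difference of two subsets with the same
  such generators is crossed evenly by every loop.
\<close>

theorem generators_bound:
  assumes fin: "finite (verts G)" "finite (arcs G)" and con: "connected G" and v: "v \<in> verts G"
    and S: "S \<subseteq> carrier (fundamental_group G arev v)" "finite S"
    and gen: "generate (fundamental_group G arev v) S = carrier (fundamental_group G arev v)"
  shows "card (arcs G) + 2 \<le> 2 * card S + 2 * card (verts G)"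
proof -
  have sc: "strongly_connected G" using con sym_arcs symmetric_connected_imp_strongly_connected by auto
  have rev: "\<forall>a\<in>arcs G. tail G (arev a) = head G a \<and> head G (arev a) = tail G a \<and> arev a \<noteq> a"
    using arev_neq by auto
  have cut: "\<forall>W. {v} \<subseteq> W \<and> W \<subset> verts G \<longrightarrow> (\<exists>a\<in>arcs G. tail G a \<in> W \<and> head G a \<in> verts G - W)"
    using connecting_arcs[OF con] by (auto simp: connecting_def)
  have "{v} \<subseteq> verts G" using v by simp
  from spanning_forest_rel[OF fin(1) this cut rev]
  obtain T where T: "T \<subseteq> arcs G" "finite T" "card T = card (verts G - {v})"
    and span: "\<forall>X. {v} \<subseteq> X \<and> (\<forall>a\<in>T. tail G a \<in> X \<longleftrightarrow> head G a \<in> X) \<longrightarrow> verts G \<subseteq> X"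
    by (elim exE conjE)
  define Q where "Q = arcs G - (T \<union> arev ` T)"
  have finQ: "finite Q" using fin(2) by (simp add: Q_def)
  have Qrev: "arev a \<in> Q" "arev a \<noteq> a" "arev (arev a) = a" if "a \<in> Q" for a
  proof -
    have "arev a \<notin> T" using that by (auto simp: Q_def image_iff)
    then show "arev a \<in> Q" using that by (auto simp: Q_def arev_eq_iff)
    show "arev a \<noteq> a" using that arev_neq by (simp add: Q_def)
  qed simp
  have "\<exists>H\<subseteq>Q. H \<inter> arev ` H = {} \<and> H \<union> arev ` H = Q"
    using finQ Qrev by (rule half_of_involution)
  then obtain H where H: "H \<subseteq> Q" "H \<inter> arev ` H = {}" "H \<union> arev ` H = Q"
    by (elim exE conjE)
  have cardQ: "card Q = 2 * card H" using card_half_of_involution[of Q arev H, OF finQ _ H] by simp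
  have "finite H" using H(1) finQ by (rule finite_subset)
  define code where "code W = {X \<in> S. \<exists>p\<in>X. crosses_oddly (W \<union> arev ` W) p}" for W
  have "inj_on code (Pow H)"
  proof (rule inj_onI)
    fix A B assume AB: "A \<in> Pow H" "B \<in> Pow H" "code A = code B"
    let ?A = "A \<union> arev ` A" and ?B = "B \<union> arev ` B"
    let ?W = "?A - ?B \<union> (?B - ?A)"
    have sym: "arev a \<in> C \<union> arev ` C \<longleftrightarrow> a \<in> C \<union> arev ` C" for a C
      by (auto simp: image_iff) (metis arev_arev)+
    then have symA: "\<forall>a. arev a \<in> ?A \<longleftrightarrow> a \<in> ?A" and symB: "\<forall>a. arev a \<in> ?B \<longleftrightarrow> a \<in> ?B" by blast+
    then have symW: "\<forall>a. arev a \<in> ?W \<longleftrightarrow> a \<in> ?W" by simp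
    have onS: "\<not> crosses_oddly ?W p" if p: "p \<in> \<Union>S" for p
    proof -
      obtain X where X: "X \<in> S" "p \<in> X" using p by blast
      then obtain q where q: "X = loop_class v q" using S(1) by (auto simp: carrier_fundamental)
      have "homotopic v p p'" if "p' \<in> X" for p'
        using loop_class_loops[of p v q] loop_class_loops[of p' v q] X(2) that q by (metis equivclp_sym equivclp_trans)
      then have "(\<exists>p'\<in>X. crosses_oddly ?A p') \<longleftrightarrow> crosses_oddly ?A p"
        "(\<exists>p'\<in>X. crosses_oddly ?B p') \<longleftrightarrow> crosses_oddly ?B p"
        using crosses_oddly_cong[OF symA] crosses_oddly_cong[OF symB] X(2) by metis+
      moreover have "X \<in> code A \<longleftrightarrow> X \<in> code B" using AB(3) by simp
      ultimately have "crosses_oddly ?A p \<longleftrightarrow> crosses_oddly ?B p" using X(1) by (simp add: code_def)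
      then show ?thesis by (simp add: crosses_oddly_sym_diff)
    qed
    have "\<not> crosses_oddly ?W p" if p: "p \<in> loops G v" for p
    proof -
      have "loop_class v p \<in> generate (fundamental_group G arev v) S"
        using p gen by (auto simp: carrier_fundamental)
      from crosses_oddly_generate[OF symW v S(1) onS this]
      obtain q where q: "loop_class v p = loop_class v q" "\<not> crosses_oddly ?W q" by blast
      have "homotopic v q p" using loop_class_self[OF p] loop_class_loops[of p v q] q(1) by simp
      then show ?thesis using q(2) crosses_oddly_cong[OF symW] by blast
    qed
    moreover have "?A \<subseteq> Q" "?B \<subseteq> Q" using AB H(3) by auto
    then have "?W \<subseteq> arcs G - T" by (auto simp: Q_def)
    ultimately have "?W = {}" using even_on_loops_imp_empty[OF symW _ sc v span T(1)] by simp
    then have "?A = ?B" by auto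
    moreover have "C = (C \<union> arev ` C) \<inter> H" if "C \<subseteq> H" for C
    proof -
      have "arev ` C \<inter> H = {}" using that H(2) by blast
      then show ?thesis using that by blast
    qed
    ultimately show "A = B" using AB(1,2) by (metis PowD)
  qed
  moreover have "code ` Pow H \<subseteq> Pow S" by (auto simp: code_def)
  ultimately have "card (Pow H) \<le> card (Pow S)" using S(2) by (intro card_inj_on_le) auto
  then have "card H \<le> card S" using \<open>finite H\<close> S(2) by (simp add: card_Pow)
  moreover have "card (arcs G) \<le> card Q + card (T \<union> arev ` T)"
  proof -
    have "card (arcs G) \<le> card (Q \<union> (T \<union> arev ` T))"
      using finQ T(2) by (intro card_mono) (auto simp: Q_def)
    then show ?thesis using card_Un_le[of Q "T \<union> arev ` T"] by linarith
  qed
  moreover have "card (T \<union> arev ` T) \<le> card T + card T"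
    using card_Un_le[of T "arev ` T"] card_image_le[OF T(2), of arev] by linarith
  moreover have "card (verts G) = Suc (card (verts G - {v}))" by (rule card.remove[OF fin(1) v])
  ultimately show ?thesis using cardQ T(3) by linarith
qed

lemma rank_bound:
  assumes fin: "finite (verts G)" "finite (arcs G)" and con: "connected G" and v: "v \<in> verts G"
    and k: "2 * k + 2 * card (verts G) \<le> card (arcs G) + 2"
  shows "enat k \<le> group_rank (fundamental_group G arev v)"
  unfolding group_rank_def
proof (rule INF_greatest)
  fix S assume "S \<in> {S. S \<subseteq> carrier (fundamental_group G arev v) \<and> finite S \<and>
    generate (fundamental_group G arev v) S = carrier (fundamental_group G arev v)}"
  then have "card (arcs G) + 2 \<le> 2 * card S + 2 * card (verts G)"
    using generators_bound[OF fin con v] by simp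
  then show "enat k \<le> enat (card S)" using k by simp
qed

end

section \<open>Stackings of primitive loops\<close>

definition circle_pred :: "nat \<Rightarrow> nat \<Rightarrow> nat" where
  "circle_pred n i = (i + (n - 1)) mod n"

lemma circle_simps [simp]:
  "verts (circle_graph n) = {..<n}" "arcs (circle_graph n) = {..<n} \<times> UNIV"
  "tail (circle_graph n) (i, True) = i" "tail (circle_graph n) (i, False) = Suc i mod n"
  "head (circle_graph n) (i, True) = Suc i mod n" "head (circle_graph n) (i, False) = i"
  by (simp_all add: circle_graph_def)

lemma circle_rev_simp [simp]: "i < n \<Longrightarrow> circle_rev n (i, b) = (i, \<not> b)"
  by (simp add: circle_rev_def)

lemma bidirected_circle: "bidirected_digraph (circle_graph n) (circle_rev n)"
proof unfold_locales
  fix a assume "a \<in> arcs (circle_graph n)"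
  then obtain i b where a: "a = (i, b)" "i < n" by auto
  then have "Suc i mod n < n" by simp
  with a show "tail (circle_graph n) a \<in> verts (circle_graph n)" "head (circle_graph n) a \<in> verts (circle_graph n)"
    "circle_rev n (circle_rev n a) = a" "tail (circle_graph n) (circle_rev n a) = head (circle_graph n) a"
    by (cases b; simp)+
next
  fix a show "a \<in> arcs (circle_graph n) \<longleftrightarrow> circle_rev n a \<noteq> a"
    by (cases a) (auto simp: circle_rev_def)
qed

lemma circle_pred_less: "0 < n \<Longrightarrow> circle_pred n i < n"
  by (simp add: circle_pred_def)

lemma Suc_circle_pred: "i < n \<Longrightarrow> Suc (circle_pred n i) mod n = i"
  by (simp add: circle_pred_def mod_Suc_eq)

lemma circle_pred_Suc: "i < n \<Longrightarrow> circle_pred n (Suc i mod n) = i"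
proof -
  assume "i < n"
  then have "Suc i + (n - 1) = i + n" by simp
  then show "circle_pred n (Suc i mod n) = i" using \<open>i < n\<close> unfolding circle_pred_def mod_add_left_eq by simp
qed

lemma circle_pred_pos: "0 < i \<Longrightarrow> i < n \<Longrightarrow> circle_pred n i = i - 1"
  using circle_pred_Suc[of "i - 1" n] by simp

lemma out_arcs_circle:
  assumes "i < n"
  shows "out_arcs (circle_graph n) i = {(i, True), (circle_pred n i, False)}"
proof -
  have "a = (i, True) \<or> a = (circle_pred n i, False)" if "a \<in> out_arcs (circle_graph n) i" for a
  proof (cases a)
    case (Pair j b)
    then show ?thesis using that circle_pred_Suc[of j n] by (cases b) auto
  qed
  moreover have "(circle_pred n i, False) \<in> out_arcs (circle_graph n) i"
    using assms Suc_circle_pred[OF assms] circle_pred_less[of n i] by simp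
  moreover have "(i, True) \<in> out_arcs (circle_graph n) i" using assms by simp
  ultimately show ?thesis by blast
qed

locale immersed_loop = G: bidirected_digraph G r
  for G :: "('w, 'f) pre_digraph" and r :: "'f \<Rightarrow> 'f" +
  fixes n :: nat and f :: "(nat, nat \<times> bool, 'w, 'f) graph_map"
  assumes n_pos: "0 < n"
    and imm: "immersion (circle_graph n) (circle_rev n) G r f"
begin

abbreviation "C \<equiv> circle_graph n"
abbreviation "rv \<equiv> circle_rev n"

sublocale C: bidirected_digraph C rv
  by (rule bidirected_circle)

lemma amap_in: "a \<in> arcs C \<Longrightarrow> amap f a \<in> arcs G"
  and tail_amap: "a \<in> arcs C \<Longrightarrow> tail G (amap f a) = vmap f (tail C a)"
  and head_amap: "a \<in> arcs C \<Longrightarrow> head G (amap f a) = vmap f (head C a)"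
  and amap_rv: "a \<in> arcs C \<Longrightarrow> amap f (rv a) = r (amap f a)"
  and vmap_in: "i \<in> verts C \<Longrightarrow> vmap f i \<in> verts G"
  using imm unfolding immersion_def graph_hom_def by blast+

lemma no_backtrack:
  assumes "i < n"
  shows "amap f (i, True) \<noteq> amap f (circle_pred n i, False)"
proof -
  have "i \<in> verts C" using assms by simp
  then have "inj_on (amap f) (out_arcs C i)" using imm unfolding immersion_def by blast
  then show ?thesis unfolding out_arcs_circle[OF assms] by simp
qed

text \<open>
  Two edges with the same image do not cross. Applied to reverse arcs, the condition gives the converse
  implication.
\<close>

definition coherent :: "(nat \<Rightarrow> int) \<Rightarrow> bool" where
  "coherent h \<longleftrightarrow> (\<forall>a\<in>arcs C. \<forall>b\<in>arcs C. amap f a = amap f b \<longrightarrow>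
     h (tail C a) < h (tail C b) \<longrightarrow> h (head C a) < h (head C b))"

text \<open>
  The vertices and arcs of the image of the circle under \<open>(\<Lambda>, h)\<close>. By coherence, reversal and the
  ends of arcs are well defined on these images.
\<close>

definition vertex_level :: "(nat \<Rightarrow> int) \<Rightarrow> nat \<Rightarrow> 'w \<times> int" where
  "vertex_level h i = (vmap f i, h i)"

definition arc_level :: "(nat \<Rightarrow> int) \<Rightarrow> nat \<times> bool \<Rightarrow> 'f \<times> int" where
  "arc_level h a = (amap f a, h (tail C a))"

lemma coherentD:
  "coherent h \<Longrightarrow> a \<in> arcs C \<Longrightarrow> b \<in> arcs C \<Longrightarrow> amap f a = amap f b \<Longrightarrow>
     h (tail C a) < h (tail C b) \<Longrightarrow> h (head C a) < h (head C b)"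
  unfolding coherent_def by blast

lemma coherent_eq:
  assumes h: "coherent h" and ab: "a \<in> arcs C" "b \<in> arcs C" "amap f a = amap f b" "h (tail C a) = h (tail C b)"
  shows "h (head C a) = h (head C b)"
proof (rule ccontr)
  have le: "\<not> h (head C a) < h (head C b)" if "a \<in> arcs C" "b \<in> arcs C" "amap f a = amap f b"
    "h (tail C a) = h (tail C b)" for a b
    using coherentD[OF h, of "rv a" "rv b"] that C.arev_in_arcs[of a] C.arev_in_arcs[of b]
      C.tail_arev[of a] C.tail_arev[of b] C.head_arev[of a] C.head_arev[of b] amap_rv[of a] amap_rv[of b] by force
  assume "h (head C a) \<noteq> h (head C b)"
  then show False using le[OF ab] le[OF ab(2,1) ab(3,4)[symmetric]] by linarith
qed

lemma arc_level_rv: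
  assumes h: "coherent h" and ab: "a \<in> arcs C" "b \<in> arcs C" "arc_level h a = arc_level h b"
  shows "arc_level h (rv a) = arc_level h (rv b)"
  using coherent_eq[OF h ab(1,2)] ab C.tail_arev[of a] C.tail_arev[of b] amap_rv[of a] amap_rv[of b]
  by (simp add: arc_level_def)

lemma arc_level_rv_iff:
  assumes h: "coherent h" and ab: "a \<in> arcs C" "b \<in> arcs C"
  shows "arc_level h (rv a) = arc_level h b \<longleftrightarrow> arc_level h a = arc_level h (rv b)"
  using arc_level_rv[OF h, of "rv a" b] arc_level_rv[OF h, of a "rv b"] ab C.arev_in_arcs[of a] C.arev_in_arcs[of b] C.arev_arev
  by metis

lemma arc_level_tail: "a \<in> arcs C \<Longrightarrow> b \<in> arcs C \<Longrightarrow> arc_level h a = arc_level h b \<Longrightarrow> vertex_level h (tail C a) = vertex_level h (tail C b)"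
  using tail_amap[of a] tail_amap[of b] by (simp add: arc_level_def vertex_level_def)

lemma arc_level_head:
  assumes "coherent h" "a \<in> arcs C" "b \<in> arcs C" "arc_level h a = arc_level h b"
  shows "vertex_level h (head C a) = vertex_level h (head C b)"
  using arc_level_tail[OF _ _ arc_level_rv[OF assms]] C.arev_in_arcs[OF assms(2)] C.arev_in_arcs[OF assms(3)]
    C.tail_arev[OF assms(2)] C.tail_arev[OF assms(3)] by simp

lemma arc_level_rv_neq: "a \<in> arcs C \<Longrightarrow> arc_level h (rv a) \<noteq> arc_level h a"
  using amap_rv[of a] G.arev_neq[OF amap_in[of a]] by (simp add: arc_level_def)

lemma arc_level_out_neq: "i < n \<Longrightarrow> arc_level h (i, True) \<noteq> arc_level h (circle_pred n i, False)"
  using no_backtrack by (simp add: arc_level_def)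

text \<open>
  The edges \<open>a1\<close> and \<open>a2\<close> of the image lie off a spanning tree \<open>T\<close>, so a combination of the two
  cocycles dual to them is a coboundary only if it is zero. One condition makes the sum over the loop
  vanish, so a nonzero combination \<open>phi\<close> has single-valued partial sums \<open>H\<close> along the loop. Adding \<open>H\<close>
  lexicographically below \<open>h\<close> keeps coherence, since \<open>phi\<close> only depends on the image of an edge. If it
  separated no further vertices, then \<open>phi\<close> would be the coboundary of \<open>H\<close>.
\<close>

lemma refine_height:
  assumes h: "coherent h" and T: "T \<subseteq> arcs C"
    and span: "\<forall>X. {vertex_level h 0} \<subseteq> X \<and> (\<forall>a\<in>T. vertex_level h (tail C a) \<in> X \<longleftrightarrow> vertex_level h (head C a) \<in> X) \<longrightarrow>
      vertex_level h ` {..<n} \<subseteq> X"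
    and a1: "a1 \<in> arcs C" "arc_level h a1 \<notin> arc_level h ` (T \<union> rv ` T)"
    and a2: "a2 \<in> arcs C" "arc_level h a2 \<notin> arc_level h ` (T \<union> rv ` T)" "arc_level h a2 \<notin> {arc_level h a1, arc_level h (rv a1)}"
  shows "\<exists>h'. coherent h' \<and> (\<forall>i<n. \<forall>j<n. vertex_level h' i = vertex_level h' j \<longrightarrow> vertex_level h i = vertex_level h j) \<and>
    (\<exists>i<n. \<exists>j<n. vertex_level h i = vertex_level h j \<and> vertex_level h' i \<noteq> vertex_level h' j)"
proof -
  define eps :: "nat \<times> bool \<Rightarrow> nat \<times> bool \<Rightarrow> int" where
    "eps a c = (if arc_level h c = arc_level h a then 1 else 0) - (if arc_level h c = arc_level h (rv a) then 1 else 0)" for a c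
  have eps_rv: "eps a (rv c) = - eps a c" if "a \<in> arcs C" "c \<in> arcs C" for a c
    using arc_level_rv_iff[OF h that(2,1)] arc_level_rv_iff[OF h that(2) C.arev_in_arcs[OF that(1)]] C.arev_arev
    by (simp add: eps_def)
  have eps_T: "eps a c = 0" if "a \<in> arcs C" "arc_level h a \<notin> arc_level h ` (T \<union> rv ` T)" "c \<in> T" for a c
  proof -
    have "c \<in> arcs C" using that(3) T by blast
    have "arc_level h a \<noteq> arc_level h c" "arc_level h a \<noteq> arc_level h (rv c)" using that(2,3) by blast+
    then show ?thesis using arc_level_rv_iff[OF h \<open>c \<in> arcs C\<close> that(1)] by (simp add: eps_def)
  qed
  define total where "total a = (\<Sum>i<n. eps a (i, True))" for a
  obtain x1 x2 :: int where x: "x1 * total a1 + x2 * total a2 = 0" "x1 \<noteq> 0 \<or> x2 \<noteq> 0"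
  proof (cases "total a1 = 0 \<and> total a2 = 0")
    case True
    then show ?thesis using that[of 1 0] by simp
  next
    case False
    then show ?thesis using that[of "total a2" "- total a1"] by auto
  qed
  define phi where "phi c = x1 * eps a1 c + x2 * eps a2 c" for c
  define H where "H i = (\<Sum>j<i. phi (j, True))" for i
  have Hn: "H n = 0"
    using x(1) by (simp add: H_def phi_def total_def sum.distrib flip: sum_distrib_left)
  have phi_rv: "phi (rv c) = - phi c" if "c \<in> arcs C" for c
    using eps_rv[OF a1(1) that] eps_rv[OF a2(1) that] by (simp add: phi_def)
  have up: "H (Suc i mod n) = H i + phi (i, True)" if "i < n" for i
  proof (cases "Suc i < n")
    case True
    then show ?thesis by (simp add: H_def)
  next
    case False
    then have "Suc i = n" using that by simp
    then have "H n = H i + phi (i, True)" by (auto simp: H_def)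
    then show ?thesis using Hn \<open>Suc i = n\<close> by (simp add: H_def)
  qed
  have step: "H (head C a) = H (tail C a) + phi a" if "a \<in> arcs C" for a
  proof -
    obtain i b where a: "a = (i, b)" "i < n" using \<open>a \<in> arcs C\<close> by auto
    show ?thesis using up[OF a(2)] phi_rv[of "(i, True)"] a by (cases b) auto
  qed
  \<comment> \<open>M exceeds all differences of H, so that M * h + H orders by h first and by H second.\<close>
  define M where "M = 2 * (\<Sum>i<n. \<bar>H i\<bar>) + 1"
  have M: "H i - H j < M" if "i < n" "j < n" for i j
  proof -
    have "\<bar>H i\<bar> \<le> (\<Sum>i<n. \<bar>H i\<bar>)" "\<bar>H j\<bar> \<le> (\<Sum>i<n. \<bar>H i\<bar>)"
      using that by (auto intro: member_le_sum)
    then show ?thesis unfolding M_def by linarith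
  qed
  define h' where "h' i = M * h i + H i" for i
  have M0: "0 \<le> M" by (simp add: M_def sum_nonneg)
  have lex1: "h' i < h' j" if "i < n" "j < n" "h i < h j" for i j
  proof -
    have "M * (h i + 1) \<le> M * h j" using M0 that(3) by (intro mult_left_mono) auto
    then show ?thesis using M[OF that(1,2)] by (simp add: h'_def algebra_simps)
  qed
  have lex: "h' i < h' j \<longleftrightarrow> h i < h j \<or> h i = h j \<and> H i < H j" if "i < n" "j < n" for i j
    using lex1[OF that] lex1[OF that(2,1)] by (cases "h i" "h j" rule: linorder_cases) (auto simp: h'_def)
  have lex_eq: "h' i = h' j \<longleftrightarrow> h i = h j \<and> H i = H j" if "i < n" "j < n" for i j
    using lex1[OF that] lex1[OF that(2,1)] by (cases "h i" "h j" rule: linorder_cases) (auto simp: h'_def)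
  have phi_level: "phi a = phi b" if "arc_level h a = arc_level h b" for a b
    using that by (simp add: phi_def eps_def)
  have ends: "tail C a < n" "head C a < n" if "a \<in> arcs C" for a
    using C.tail_in_verts[OF that] C.head_in_verts[OF that] by simp_all
  have "coherent h'"
    unfolding coherent_def
  proof (intro ballI impI)
    fix a b assume ab: "a \<in> arcs C" "b \<in> arcs C" "amap f a = amap f b" "h' (tail C a) < h' (tail C b)"
    then consider "h (tail C a) < h (tail C b)" | "h (tail C a) = h (tail C b)" "H (tail C a) < H (tail C b)"
      using lex ends by blast
    then show "h' (head C a) < h' (head C b)"
    proof cases
      case 1
      then show ?thesis using coherentD[OF h ab(1-3)] lex1 ends ab by blast
    next
      case 2
      then have "phi a = phi b" using ab(3) by (intro phi_level) (simp add: arc_level_def)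
      then have "H (head C a) < H (head C b)" using 2 step ab(1,2) by simp
      moreover have "h (head C a) = h (head C b)" using coherent_eq[OF h ab(1-3) 2(1)] .
      ultimately show ?thesis using lex ends ab(1,2) by blast
    qed
  qed
  moreover have "\<forall>i<n. \<forall>j<n. vertex_level h' i = vertex_level h' j \<longrightarrow> vertex_level h i = vertex_level h j"
  proof (intro allI impI)
    fix i j assume "i < n" "j < n" "vertex_level h' i = vertex_level h' j"
    then show "vertex_level h i = vertex_level h j" using lex_eq[of i j] unfolding vertex_level_def by simp
  qed
  moreover have "\<exists>i<n. \<exists>j<n. vertex_level h i = vertex_level h j \<and> vertex_level h' i \<noteq> vertex_level h' j"
  proof (rule ccontr)
    assume no: "\<not> ?thesis"
    have same: "H i = H j" if "i < n" "j < n" "vertex_level h i = vertex_level h j" for i j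
    proof -
      have "vertex_level h' i = vertex_level h' j" using no that by blast
      then have "h' i = h' j" unfolding vertex_level_def by simp
      then show ?thesis using lex_eq[OF that(1,2)] by simp
    qed
    define X where "X = vertex_level h ` {i. i < n \<and> H i = 0}"
    have X: "vertex_level h i \<in> X \<longleftrightarrow> H i = 0" if "i < n" for i
    proof
      assume "vertex_level h i \<in> X"
      then obtain j where "j < n" "H j = 0" "vertex_level h i = vertex_level h j" unfolding X_def by blast
      then show "H i = 0" using same[OF that \<open>j < n\<close>] by simp
    next
      assume "H i = 0"
      then show "vertex_level h i \<in> X" using that unfolding X_def by blast
    qed
    have "{vertex_level h 0} \<subseteq> X" using X[of 0] n_pos by (simp add: H_def)
    moreover have "vertex_level h (tail C a) \<in> X \<longleftrightarrow> vertex_level h (head C a) \<in> X" if "a \<in> T" for a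
    proof -
      have a: "a \<in> arcs C" using that T by blast
      have "phi a = 0" using eps_T[OF a1 that] eps_T[OF a2(1,2) that] by (simp add: phi_def)
      then show ?thesis using X ends[OF a] step[OF a] by simp
    qed
    ultimately have "vertex_level h ` {..<n} \<subseteq> X" using span by blast
    then have H0: "H i = 0" if "i < n" for i using X that by blast
    then have phi0: "phi a = 0" if "a \<in> arcs C" for a using step[OF that] ends[OF that] by simp
    have "arc_level h a1 \<noteq> arc_level h a2" "arc_level h a2 \<noteq> arc_level h (rv a1)" using a2(3) by auto
    moreover from this have "arc_level h a1 \<noteq> arc_level h (rv a2)"
      using arc_level_rv_iff[OF h a2(1) a1(1)] by auto
    moreover have "arc_level h a1 \<noteq> arc_level h (rv a1)" "arc_level h a2 \<noteq> arc_level h (rv a2)"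
      using arc_level_rv_neq[OF a1(1)] arc_level_rv_neq[OF a2(1)] by metis+
    ultimately have "phi a1 = x1" "phi a2 = x2" by (simp_all add: phi_def eps_def)
    then show False using phi0[OF a1(1)] phi0[OF a2(1)] x(2) by simp
  qed
  ultimately show ?thesis by blast
qed

definition out_levels :: "(nat \<Rightarrow> int) \<Rightarrow> 'w \<times> int \<Rightarrow> ('f \<times> int) set" where
  "out_levels h x = arc_level h ` {a \<in> arcs C. vertex_level h (tail C a) = x}"

lemma finite_out_levels: "finite (out_levels h x)"
  by (simp add: out_levels_def)

lemma two_out_levels:
  assumes "i < n"
  shows "{arc_level h (i, True), arc_level h (circle_pred n i, False)} \<subseteq> out_levels h (vertex_level h i)"
    and "card {arc_level h (i, True), arc_level h (circle_pred n i, False)} = 2"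
proof -
  have "(i, True) \<in> {a \<in> arcs C. vertex_level h (tail C a) = vertex_level h i}"
    "(circle_pred n i, False) \<in> {a \<in> arcs C. vertex_level h (tail C a) = vertex_level h i}"
    using assms Suc_circle_pred[OF assms] circle_pred_less[of n i] by simp_all
  then show "{arc_level h (i, True), arc_level h (circle_pred n i, False)} \<subseteq> out_levels h (vertex_level h i)"
    unfolding out_levels_def by blast
  show "card {arc_level h (i, True), arc_level h (circle_pred n i, False)} = 2"
    using arc_level_out_neq[OF assms, of h] by simp
qed

text \<open>
  If one valence of the image is not two, it is larger, as the loop is immersed. Then the image has
  more edges than vertices, and at least two edges lie off a spanning tree.
\<close>

lemma branching_refine:
  assumes h: "coherent h" and i0: "i0 < n" "card (out_levels h (vertex_level h i0)) \<noteq> 2"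
  shows "\<exists>h'. coherent h' \<and> (\<forall>i<n. \<forall>j<n. vertex_level h' i = vertex_level h' j \<longrightarrow> vertex_level h i = vertex_level h j) \<and>
    (\<exists>i<n. \<exists>j<n. vertex_level h i = vertex_level h j \<and> vertex_level h' i \<noteq> vertex_level h' j)"
proof -
  let ?V = "vertex_level h ` {..<n}"
  have finV: "finite ?V" by simp
  let ?tl = "\<lambda>a. vertex_level h (tail C a)" and ?hd = "\<lambda>a. vertex_level h (head C a)"
  have rev: "\<forall>a\<in>arcs C. ?tl (rv a) = ?hd a \<and> ?hd (rv a) = ?tl a \<and> rv a \<noteq> a"
    using C.tail_arev C.head_arev C.arev_neq by simp
  have cut: "\<forall>W. {vertex_level h 0} \<subseteq> W \<and> W \<subset> ?V \<longrightarrow> (\<exists>a\<in>arcs C. ?tl a \<in> W \<and> ?hd a \<in> ?V - W)"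
  proof (intro allI impI)
    fix W assume W: "{vertex_level h 0} \<subseteq> W \<and> W \<subset> ?V"
    then obtain j where j: "j < n" "vertex_level h j \<notin> W" by blast
    define i where "i = (LEAST i. vertex_level h i \<notin> W)"
    have i: "vertex_level h i \<notin> W" "i \<le> j" using j(2) unfolding i_def by (rule LeastI, rule Least_le)
    have "i \<noteq> 0" using i(1) W by auto
    then have "vertex_level h (i - 1) \<in> W" using not_less_Least[of "i - 1" "\<lambda>i. vertex_level h i \<notin> W"] by (auto simp: i_def)
    moreover have "Suc (i - 1) mod n = i" using \<open>i \<noteq> 0\<close> i(2) j(1) by simp
    ultimately show "\<exists>a\<in>arcs C. ?tl a \<in> W \<and> ?hd a \<in> ?V - W"
      using i j(1) by (intro bexI[of _ "(i - 1, True)"]) auto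
  qed
  have "{vertex_level h 0} \<subseteq> ?V" using n_pos by auto
  from spanning_forest_rel[OF finV this cut rev]
  obtain T where T: "T \<subseteq> arcs C" "finite T" "card T = card (?V - {vertex_level h 0})"
    and span: "\<forall>X. {vertex_level h 0} \<subseteq> X \<and> (\<forall>a\<in>T. ?tl a \<in> X \<longleftrightarrow> ?hd a \<in> X) \<longrightarrow> ?V \<subseteq> X"
    by (elim exE conjE)
  let ?K = "arc_level h ` arcs C" and ?KT = "arc_level h ` (T \<union> rv ` T)"
  \<comment> \<open>In terms of arcs: at most 2 |V| - 2 arcs lie on the tree and there are more than 2 |V| arcs.
    So three arcs are off the tree, of which at most two belong to the edge of a1.\<close>
  have "card ?KT \<le> card (T \<union> rv ` T)" using T(2) by (intro card_image_le) simp
  also have "\<dots> \<le> card T + card T"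
    by (rule order_trans[OF card_Un_le add_left_mono[OF card_image_le[OF T(2)]]])
  finally have KT1: "card ?KT \<le> card T + card T" .
  have "vertex_level h 0 \<in> ?V" using n_pos by blast
  then have "card ?V = Suc (card T)" unfolding T(3) by (rule card.remove[OF finV])
  with KT1 have KT: "card ?KT + 2 \<le> 2 * card ?V" by presburger
  have K: "2 * card ?V < card ?K"
  proof -
    have ge: "2 \<le> card (out_levels h x)" if x: "x \<in> ?V" for x
    proof -
      obtain i where "i < n" "x = vertex_level h i" using x by blast
      then show ?thesis using two_out_levels[of i h] card_mono[OF finite_out_levels] by metis
    qed
    have "card (out_levels h (vertex_level h i0)) > 2" using ge[of "vertex_level h i0"] i0 by simp
    then have "(\<Sum>x\<in>?V. 2) < (\<Sum>x\<in>?V. card (out_levels h x))"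
      using ge i0(1) by (intro sum_strict_mono_ex1) auto
    also have "\<dots> = card (\<Union>x\<in>?V. out_levels h x)"
    proof (intro card_UN_disjoint[symmetric] ballI impI)
      fix x y assume "x \<in> ?V" "y \<in> ?V" "x \<noteq> y"
      then show "out_levels h x \<inter> out_levels h y = {}"
        using arc_level_tail unfolding out_levels_def by blast
    qed (auto intro: finite_out_levels)
    also have "(\<Union>x\<in>?V. out_levels h x) = ?K"
    proof
      show "?K \<subseteq> (\<Union>x\<in>?V. out_levels h x)"
      proof
        fix k assume "k \<in> ?K"
        then obtain a where a: "a \<in> arcs C" "k = arc_level h a" by blast
        then have "k \<in> out_levels h (?tl a)" unfolding out_levels_def by blast
        moreover have "?tl a \<in> ?V" using C.tail_in_verts[OF a(1)] by simp
        ultimately show "k \<in> (\<Union>x\<in>?V. out_levels h x)" by blast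
      qed
    qed (auto simp: out_levels_def)
    finally show ?thesis by simp
  qed
  have finKT: "finite ?KT" using T(2) by simp
  have "card ?K - card ?KT \<le> card (?K - ?KT)" by (rule diff_card_le_card_Diff[OF finKT])
  then have three: "3 \<le> card (?K - ?KT)" using K KT by linarith
  then obtain k1 where "k1 \<in> ?K - ?KT" by (metis card.empty equals0I not_numeral_le_zero)
  then obtain a1 where a1: "a1 \<in> arcs C" "arc_level h a1 \<notin> ?KT" by blast
  have "card (?K - ?KT) - card {arc_level h a1, arc_level h (rv a1)} \<le> card (?K - ?KT - {arc_level h a1, arc_level h (rv a1)})"
    by (rule diff_card_le_card_Diff) simp
  moreover have "card {arc_level h a1, arc_level h (rv a1)} \<le> 2" by (simp add: card_insert_if)
  ultimately have "1 \<le> card (?K - ?KT - {arc_level h a1, arc_level h (rv a1)})" using three by linarith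
  then obtain k2 where "k2 \<in> ?K - ?KT - {arc_level h a1, arc_level h (rv a1)}" by (metis card.empty equals0I not_one_le_zero)
  then obtain a2 where a2: "a2 \<in> arcs C" "arc_level h a2 \<notin> ?KT" "arc_level h a2 \<notin> {arc_level h a1, arc_level h (rv a1)}" by blast
  show ?thesis by (rule refine_height[OF h T(1) span a1 a2])
qed

text \<open>
  A period \<open>d\<close> gives the period \<open>gcd d n\<close>, which divides \<open>n\<close>. The loop then factors through the
  circle with \<open>gcd d n\<close> edges.
\<close>

lemma periodic_imp_not_primitive:
  assumes d: "0 < d" "d < n" and per: "\<And>m. amap f (m mod n, True) = amap f ((m + d) mod n, True)"
  shows "\<not> primitive_loop n G r f"
proof -
  define L where "L m = amap f (m mod n, True)" for m
  define g where "g = gcd d n"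
  have g: "0 < g" "g dvd n" "g < n"
    using d by (auto simp: g_def intro: gcd_pos_nat le_less_trans[OF gcd_le1_nat])
  have Ld: "L (m + d * x) = L m" for m x
  proof (induction x)
    case (Suc x)
    have "L (m + d * Suc x) = L (m + d * x + d)" by (simp add: algebra_simps)
    then show ?case using per[of "m + d * x"] Suc by (simp add: L_def)
  qed simp
  obtain x y where xy: "d * x = n * y + g" using bezout_nat[of d n] d by (auto simp: g_def)
  have Lg1: "L (m + g) = L m" for m
  proof -
    have "L (m + g) = L (m + g + n * y)" by (simp add: L_def)
    also have "\<dots> = L (m + d * x)" using xy by (simp add: algebra_simps)
    finally show ?thesis using Ld by simp
  qed
  have "L (m + g * k) = L m" for m k
  proof (induction k)
    case (Suc k)
    have "L (m + g * Suc k) = L (m + g * k + g)" by (simp add: algebra_simps)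
    then show ?case using Lg1 Suc by simp
  qed simp
  then have Lg: "L (m mod g) = L m" for m by (metis mod_mult_div_eq)
  have Lv: "vmap f (m mod n) = tail G (L m)" for m
    using tail_amap[of "(m mod n, True)"] n_pos by (simp add: L_def)
  have amap_T: "amap f (m, True) = L m" and amap_F: "amap f (m, False) = r (L m)" if "m < n" for m
    using that amap_rv[of "(m, True)"] by (simp_all add: L_def)
  have vg: "vmap f (m mod g) = vmap f m" if "m < n" for m
  proof -
    have "m mod g < n" using g by (meson mod_less_divisor less_trans)
    then show ?thesis using Lv[of "m mod g"] Lv[of m] Lg[of m] that by simp
  qed
  have mod_g: "(m mod n) mod g = m mod g" for m using g(2) by (rule mod_mod_cancel)
  have circle_pred_g: "circle_pred n i mod g = circle_pred g (i mod g)" for i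
  proof -
    obtain k where k: "n = g * k" using g(2) by blast
    then have "0 < k" using n_pos by (cases k) auto
    then obtain k' where "k = Suc k'" by (cases k) auto
    then have eq: "i + (n - 1) = i + (g - 1) + g * k'" using k g(1) by (simp add: algebra_simps)
    have "circle_pred n i mod g = (i + (n - 1)) mod g" unfolding circle_pred_def by (rule mod_g)
    also have "\<dots> = (i + (g - 1)) mod g" unfolding eq by (rule mod_mult_self2)
    finally show ?thesis by (simp add: circle_pred_def mod_add_left_eq)
  qed
  let ?p = "\<lparr>vmap = \<lambda>i. i mod g, amap = \<lambda>(i, b). (i mod g, b)\<rparr> :: (nat, nat \<times> bool, nat, nat \<times> bool) graph_map"
  let ?D = "circle_graph g"
  have "graph_hom C rv ?D (circle_rev g) ?p"
    unfolding graph_hom_def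
  proof (intro conjI ballI)
    fix a assume "a \<in> arcs C"
    then obtain i b where a: "a = (i, b)" "i < n" by auto
    show "amap ?p a \<in> arcs ?D" using a g(1) by simp
    show "tail ?D (amap ?p a) = vmap ?p (tail C a)" "head ?D (amap ?p a) = vmap ?p (head C a)"
      using a mod_g[of "Suc i"] by (cases b; simp add: mod_Suc_eq)+
    show "amap ?p (rv a) = circle_rev g (amap ?p a)" using a g(1) by simp
  qed (use g(1) in simp)
  moreover have "bij_betw (amap ?p) (out_arcs C i) (out_arcs ?D (vmap ?p i))" if "i \<in> verts C" for i
  proof -
    have "i < n" "i mod g < g" using that g(1) by simp_all
    then show ?thesis unfolding out_arcs_circle[OF \<open>i < n\<close>]
      using out_arcs_circle[OF \<open>i mod g < g\<close>] circle_pred_g[of i] by (simp add: bij_betw_def inj_on_def)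
  qed
  moreover have "card {v \<in> verts C. vmap ?p v = w} = n div g" if "w \<in> verts ?D" for w
  proof -
    have w: "w < g" using that by simp
    have "{v \<in> verts C. vmap ?p v = w} = (\<lambda>q. w + g * q) ` {..<n div g}"
    proof (intro Set.set_eqI iffI)
      fix v assume "v \<in> {v \<in> verts C. vmap ?p v = w}"
      then have v: "v < n" "v mod g = w" by auto
      have "v div g < n div g" using v(1) g(2) by (metis div_mult_mod_eq dvd_div_mult_self dvd_imp_mod_0 less_mult_imp_div_less)
      moreover have "v = w + g * (v div g)" using v(2) by (metis mod_mult_div_eq)
      ultimately show "v \<in> (\<lambda>q. w + g * q) ` {..<n div g}" by blast
    next
      fix v assume "v \<in> (\<lambda>q. w + g * q) ` {..<n div g}"
      then obtain q where q: "q < n div g" "v = w + g * q" by blast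
      have "v < g * Suc q" using q w by simp
      also have "\<dots> \<le> g * (n div g)" using q(1) by (intro mult_le_mono2) simp
      also have "\<dots> = n" using g(2) by simp
      finally show "v \<in> {v \<in> verts C. vmap ?p v = w}" using q w by simp
    qed
    then show ?thesis using g(1) by (simp add: card_image inj_on_def)
  qed
  ultimately have cov: "covering_of_degree (n div g) C rv ?D (circle_rev g) ?p"
    unfolding covering_of_degree_def by blast
  have "1 < n div g" using g by (metis One_nat_def dvd_div_eq_0_iff dvd_mult_div_cancel linorder_neqE_nat mult.right_neutral n_pos less_one less_numeral_extra(4) not_less_zero less_irrefl)
  moreover have "immersion ?D (circle_rev g) G r f"
    unfolding immersion_def
  proof
    show "graph_hom ?D (circle_rev g) G r f"
      unfolding graph_hom_def
    proof (intro conjI ballI)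
      fix a assume "a \<in> arcs ?D"
      then obtain i b where a: "a = (i, b)" "i < g" "i < n" using g(3) by auto
      show "amap f a \<in> arcs G" using a by (intro amap_in) simp
      have "vmap f (Suc i mod g) = vmap f (Suc i mod n)"
        using vg[of "Suc i mod n"] mod_g[of "Suc i"] n_pos by simp
      then show "tail G (amap f a) = vmap f (tail ?D a)" "head G (amap f a) = vmap f (head ?D a)"
        using a tail_amap[of a] head_amap[of a] by (cases b; simp)+
      show "amap f (circle_rev g a) = r (amap f a)" using a amap_rv[of a] by simp
    qed (use g(3) vmap_in in force)
    show "\<forall>v\<in>verts ?D. inj_on (amap f) (out_arcs ?D v)"
    proof
      fix v assume "v \<in> verts ?D"
      then have v: "v < g" "v < n" using g(3) by simp_all
      have lt: "circle_pred g v < n" "circle_pred n v < n" using circle_pred_less[OF g(1), of v] circle_pred_less[OF n_pos, of v] g(3) by simp_all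
      have "L (circle_pred g v) = L (circle_pred n v)" using Lg[of "circle_pred n v"] circle_pred_g[of v] v(1) by simp
      then have "amap f (circle_pred g v, False) = amap f (circle_pred n v, False)" using amap_F lt by simp
      then show "inj_on (amap f) (out_arcs ?D v)"
        using no_backtrack[OF v(2)] by (simp add: out_arcs_circle[OF v(1)])
    qed
  qed
  moreover have "\<forall>v\<in>verts C. vmap f v = vmap f (vmap ?p v)" using vg by simp
  moreover have "amap f a = amap f (amap ?p a)" if aC: "a \<in> arcs C" for a
  proof -
    obtain i b where a: "a = (i, b)" "i < n" using aC by auto
    have "i mod g < n" using g by (meson mod_less_divisor less_trans)
    then show ?thesis using a Lg[of i] amap_T amap_F by (cases b) simp_all
  qed
  ultimately show ?thesis using cov g(1) unfolding primitive_loop_def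
    by (metis (no_types, lifting) One_nat_def Suc_leI)
qed

text \<open>
  With all valences two, the two arcs at a vertex of the image determine each other. Suppose that the
  loop visits a vertex of the image at times \<open>i\<close> and \<open>j\<close>. If it leaves by the same arc both times, the
  two continuations agree forever and the loop is periodic. Otherwise it runs from \<open>i\<close> forwards as from
  \<open>j\<close> backwards, and where the two runs meet it turns back at a vertex or inverts an edge.
\<close>

lemma unbranched_imp_injective:
  assumes h: "coherent h" and two: "\<And>i. i < n \<Longrightarrow> card (out_levels h (vertex_level h i)) = 2"
    and prim: "primitive_loop n G r f" and ij: "i < j" "j < n"
  shows "vertex_level h i \<noteq> vertex_level h j"
proof
  assume eq: "vertex_level h i = vertex_level h j"
  have out: "out_levels h (vertex_level h x) = {arc_level h (x, True), arc_level h (circle_pred n x, False)}" if "x < n" for x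
    using card_subset_eq[OF finite_out_levels two_out_levels(1)[OF that]] two_out_levels(2)[OF that] two[OF that] by metis
  have same: "{arc_level h (x, True), arc_level h (circle_pred n x, False)} = {arc_level h (y, True), arc_level h (circle_pred n y, False)}"
    if "x < n" "y < n" "vertex_level h x = vertex_level h y" for x y
    using out[OF that(1)] out[OF that(2)] that(3) by simp
  have "i < n" using ij by simp
  have neq: "arc_level h (x, True) \<noteq> arc_level h (x, False)" if "x < n" for x
    using arc_level_rv_neq[of "(x, False)" h] that by simp
  consider "arc_level h (i, True) = arc_level h (j, True)" | "arc_level h (i, True) = arc_level h (circle_pred n j, False)"
    using same[OF \<open>i < n\<close> ij(2) eq] by blast
  then show False
  proof cases
    case 1
    have shift: "arc_level h ((i + k) mod n, True) = arc_level h ((j + k) mod n, True)" for k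
    proof (induction k)
      case 0
      then show ?case using 1 ij \<open>i < n\<close> by simp
    next
      case (Suc k)
      define x where "x = (i + k) mod n"
      define y where "y = (j + k) mod n"
      have xy: "x < n" "y < n" using n_pos by (simp_all add: x_def y_def)
      have k: "arc_level h (x, True) = arc_level h (y, True)" using Suc by (simp add: x_def y_def)
      have kF: "arc_level h (x, False) = arc_level h (y, False)"
        using arc_level_rv[OF h _ _ k] xy by simp
      have v: "vertex_level h (Suc x mod n) = vertex_level h (Suc y mod n)" using arc_level_head[OF h _ _ k] xy by simp
      have "{arc_level h (Suc x mod n, True), arc_level h (x, False)} = {arc_level h (Suc y mod n, True), arc_level h (y, False)}"
        using same[OF _ _ v] xy n_pos circle_pred_Suc by simp
      moreover have "arc_level h (Suc x mod n, True) \<noteq> arc_level h (x, False)"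
        using arc_level_out_neq[of "Suc x mod n" h] xy n_pos circle_pred_Suc[OF xy(1)] by simp
      ultimately have "arc_level h (Suc x mod n, True) = arc_level h (Suc y mod n, True)"
        using kF by (auto simp: doubleton_eq_iff)
      then show ?case by (simp add: x_def y_def mod_Suc_eq)
    qed
    have "amap f (m mod n, True) = amap f ((m + (j - i)) mod n, True)" for m
    proof -
      have "(i + (m + (n - i))) mod n = m mod n"
        "(j + (m + (n - i))) mod n = (m + (j - i)) mod n"
      proof -
        have "i + (m + (n - i)) = m + n" "j + (m + (n - i)) = (m + (j - i)) + n" using ij by simp_all
        then show "(i + (m + (n - i))) mod n = m mod n"
          "(j + (m + (n - i))) mod n = (m + (j - i)) mod n" by (simp_all only: mod_add_self2)
      qed
      then show ?thesis using shift[of "m + (n - i)"] by (simp add: arc_level_def)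
    qed
    moreover have "0 < j - i" "j - i < n" using ij by simp_all
    ultimately show False using periodic_imp_not_primitive prim by blast
  next
    case 2
    have fold: "arc_level h (i + k, True) = arc_level h (j - 1 - k, False)" if "i + 2 * k < j" for k
      using that
    proof (induction k)
      case 0
      then show ?case using 2 ij circle_pred_pos[of j n] by simp
    next
      case (Suc k)
      define x where "x = i + k"
      define y where "y = j - 1 - k"
      have xy: "Suc x < n" "y < n" "0 < y" using Suc.prems ij(2) by (simp_all add: x_def y_def)
      have k: "arc_level h (x, True) = arc_level h (y, False)" using Suc by (simp add: x_def y_def)
      have kF: "arc_level h (x, False) = arc_level h (y, True)" using arc_level_rv[OF h _ _ k] xy by simp
      have v: "vertex_level h (Suc x) = vertex_level h y" using arc_level_head[OF h _ _ k] xy by simp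
      have "{arc_level h (Suc x, True), arc_level h (x, False)} = {arc_level h (y, True), arc_level h (y - 1, False)}"
        using same[OF _ _ v] xy circle_pred_pos[of "Suc x" n] circle_pred_pos[of y n] by simp
      moreover have "arc_level h (Suc x, True) \<noteq> arc_level h (x, False)"
        using arc_level_out_neq[of "Suc x" h] xy circle_pred_pos[of "Suc x" n] by simp
      ultimately have "arc_level h (Suc x, True) = arc_level h (y - 1, False)"
        using kF by (auto simp: doubleton_eq_iff)
      then show ?case by (simp add: x_def y_def)
    qed
    obtain k where "j - Suc i = 2 * k \<or> j - Suc i = 2 * k + 1" by (metis evenE oddE)
    then have jk: "j = Suc (i + 2 * k) \<or> j = Suc (Suc (i + 2 * k))" using ij(1) by linarith
    then have k: "i + 2 * k < j" by linarith
    have "j - 1 - k = i + k \<or> j - 1 - k = Suc (i + k)" using jk by linarith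
    then show False
    proof
      assume "j - 1 - k = i + k"
      then show False using fold[OF k] neq[of "i + k"] k ij by simp
    next
      assume e: "j - 1 - k = Suc (i + k)"
      then have lt: "Suc (i + k) < n" using ij by linarith
      have "arc_level h (i + k, True) = arc_level h (Suc (i + k), False)" using fold[OF k] e by simp
      then have "arc_level h (i + k, False) = arc_level h (Suc (i + k), True)"
        using arc_level_rv[OF h, of "(i + k, True)" "(Suc (i + k), False)"] lt by simp
      then show False using arc_level_out_neq[OF lt, of h] circle_pred_pos[of "Suc (i + k)" n] lt by simp
    qed
  qed
qed

text \<open>
  The number of pairs of vertices with the same image and the same height decreases with each
  refinement.
\<close>

theorem stacking_exists:
  assumes prim: "primitive_loop n G r f"
  shows "\<exists>h. coherent h \<and> (\<forall>i<n. \<forall>j<n. vmap f i = vmap f j \<and> h i = h j \<longrightarrow> i = j)"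
proof -
  define E where "E h = {(i, j). i < n \<and> j < n \<and> vertex_level h i = vertex_level h j}" for h
  have fin: "finite (E h)" for h
    by (rule finite_subset[of _ "{..<n} \<times> {..<n}"]) (auto simp: E_def)
  have "\<exists>h'. coherent h' \<and> (\<forall>i<n. \<forall>j<n. vertex_level h' i = vertex_level h' j \<longrightarrow> i = j)" if "coherent h" for h
    using that
  proof (induction "card (E h)" arbitrary: h rule: less_induct)
    case less
    show ?case
    proof (cases "\<exists>i<n. card (out_levels h (vertex_level h i)) \<noteq> 2")
      case True
      then obtain h' where h': "coherent h'" "\<forall>i<n. \<forall>j<n. vertex_level h' i = vertex_level h' j \<longrightarrow> vertex_level h i = vertex_level h j"
        "\<exists>i<n. \<exists>j<n. vertex_level h i = vertex_level h j \<and> vertex_level h' i \<noteq> vertex_level h' j"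
        using branching_refine[OF less.prems] by blast
      have "E h' \<subset> E h"
      proof
        show "E h' \<subseteq> E h" using h'(2) by (auto simp: E_def)
        show "E h' \<noteq> E h" using h'(3) by (auto simp: E_def)
      qed
      then have "card (E h') < card (E h)" by (rule psubset_card_mono[OF fin])
      then show ?thesis using less.hyps h'(1) by blast
    next
      case False
      then have "vertex_level h i \<noteq> vertex_level h j" if "i < j" "j < n" for i j
        using unbranched_imp_injective[OF less.prems _ prim that] by blast
      then show ?thesis using less.prems by (metis linorder_neqE_nat)
    qed
  qed
  moreover have "coherent (\<lambda>_. 0)" by (simp add: coherent_def)
  ultimately show ?thesis by (fastforce simp: vertex_level_def)
qed

end

section \<open>Circular components of the fibre product\<close>

text \<open>
  Maximality forces a connected component to contain everything reachable from one of its vertices.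
\<close>

lemma (in sym_digraph) components_subset_sccs: "components G \<subseteq> sccs"
proof
  fix H assume "H \<in> components G"
  then have H: "subgraph H G" "connected H"
    and max: "\<And>H'. subgraph H H' \<Longrightarrow> subgraph H' G \<Longrightarrow> connected H' \<Longrightarrow> H' = H"
    unfolding components_def max_subgraph_def by blast+
  obtain u where u: "u \<in> verts H" using H(2) by (auto simp: connected_def strongly_connected_def)
  let ?D = "G \<restriction> {v. u \<rightarrow>\<^sup>* v}"
  have "u \<in> verts G" using H(1) u by auto
  then have D: "?D \<in> sccs" by (rule induce_reachable_is_in_sccs)
  then have ind: "induced_subgraph ?D G" and sc: "strongly_connected ?D" by (auto simp: sccs_def)
  then interpret D: wf_digraph ?D by (intro wf_digraphI_induced)
  have "connected ?D"
    using sc D.reachable_mk_symmetricI unfolding connected_def strongly_connected_def by simp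
  moreover have vH: "verts H \<subseteq> {v. u \<rightarrow>\<^sup>* v}"
  proof
    fix y assume "y \<in> verts H"
    then have "u \<rightarrow>\<^sup>*\<^bsub>mk_symmetric H\<^esub> y" using H(2) u by (simp add: connected_def strongly_connected_def)
    then have "u \<rightarrow>\<^sup>*\<^bsub>mk_symmetric G\<^esub> y"
      using subgraph_mk_symmetric[OF H(1)] by (rule pre_digraph.reachable_mono)
    then show "y \<in> {v. u \<rightarrow>\<^sup>* v}" using reachable_mk_symmetric_eq[OF sym_arcs] by simp
  qed
  moreover have "subgraph H ?D"
  proof (rule subgraphI)
    have wfH: "wf_digraph H" and aH: "arcs H \<subseteq> arcs G" and cp: "compatible G H" using H(1) by auto
    have "e \<in> arcs ?D" if e: "e \<in> arcs H" for e
    proof -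
      have "tail H e \<in> verts H" "head H e \<in> verts H"
        using wf_digraph.tail_in_verts[OF wfH e] wf_digraph.head_in_verts[OF wfH e] .
      then show ?thesis using vH aH e compatible_tail[OF cp] compatible_head[OF cp] by auto
    qed
    then show "arcs H \<subseteq> arcs ?D" by blast
    show "compatible ?D H" using cp by (simp add: compatible_def)
    show "verts H \<subseteq> verts ?D" using vH by simp
    show "wf_digraph H" by (rule wfH)
    show "wf_digraph ?D" by unfold_locales
  qed
  ultimately have "?D = H" using max induced_imp_subgraph[OF ind] by blast
  then show "H \<in> sccs" using D by simp
qed

text \<open>
  A circle with one edge has two arcs at its vertex as well, the two ends of the loop.
\<close>

lemma circular_two_out:
  assumes "circular K s" and x: "x \<in> verts K"
  shows "\<exists>b\<in>arcs K. \<exists>b'\<in>arcs K. b \<noteq> b' \<and> tail K b = x \<and> tail K b' = x"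
proof -
  obtain m g where g: "graph_iso (circle_graph m) (circle_rev m) K s g"
    using assms(1) by (auto simp: circular_def)
  have hom: "graph_hom (circle_graph m) (circle_rev m) K s g"
    and inj: "inj_on (amap g) (arcs (circle_graph m))"
    and im: "vmap g ` verts (circle_graph m) = verts K"
    using g by (auto simp: graph_iso_def bij_betw_def)
  obtain i where i: "i < m" "x = vmap g i" using x im by auto
  let ?a = "(i, True)" and ?b = "(circle_pred m i, False)"
  have ab: "?a \<in> out_arcs (circle_graph m) i" "?b \<in> out_arcs (circle_graph m) i"
    by (simp_all only: out_arcs_circle[OF i(1)] insertI1 insertI2)
  have "amap g ?a \<noteq> amap g ?b" using inj ab by (auto dest: inj_onD)
  moreover have "amap g a \<in> arcs K \<and> tail K (amap g a) = x" if "a \<in> out_arcs (circle_graph m) i" for a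
    using hom that i(2) unfolding graph_hom_def in_out_arcs_conv by blast
  ultimately show ?thesis using ab by blast
qed

lemma circular_rev_closed:
  assumes "circular K s" and b: "b \<in> arcs K"
  shows "s b \<in> arcs K"
proof -
  obtain m g where g: "graph_iso (circle_graph m) (circle_rev m) K s g"
    using assms(1) by (auto simp: circular_def)
  interpret C: bidirected_digraph "circle_graph m" "circle_rev m" by (rule bidirected_circle)
  have im: "amap g ` arcs (circle_graph m) = arcs K" using g by (simp add: graph_iso_def bij_betw_def)
  obtain a where a: "a \<in> arcs (circle_graph m)" "b = amap g a" using b im by blast
  then have "s b = amap g (circle_rev m a)" using g by (simp only: graph_iso_def graph_hom_def)
  then show ?thesis using im C.arev_in_arcs[OF a(1)] by blast
qed

locale lifted_loop = immersed_loop G r n f + G': bidirected_digraph G' r' + G': fin_digraph G'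
  for G :: "('w, 'f) pre_digraph" and r n f and G' :: "('v, 'e) pre_digraph" and r' :: "'e \<Rightarrow> 'e" +
  fixes g :: "('v, 'e, 'w, 'f) graph_map"
  assumes imm_g: "immersion G' r' G r g"
    and prim: "primitive_loop n G r f"
begin

definition "P = fibre_product G' C g f"
definition "pr = fibre_product_rev G' r' C rv g f"
definition "Q = circular_part P pr"
definition "circles = {K \<in> components P. circular K pr}"

lemma g_simps:
  "a \<in> arcs G' \<Longrightarrow> tail G (amap g a) = vmap g (tail G' a)"
  "a \<in> arcs G' \<Longrightarrow> head G (amap g a) = vmap g (head G' a)"
  "a \<in> arcs G' \<Longrightarrow> amap g (r' a) = r (amap g a)"
  using imm_g unfolding immersion_def graph_hom_def by blast+

lemma g_inj:
  "a \<in> arcs G' \<Longrightarrow> b \<in> arcs G' \<Longrightarrow> tail G' a = tail G' b \<Longrightarrow> amap g a = amap g b \<Longrightarrow> a = b"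
  using imm_g G'.tail_in_verts[of a] unfolding immersion_def inj_on_def by (metis in_out_arcs_conv)

lemma f_inj:
  "a \<in> arcs C \<Longrightarrow> b \<in> arcs C \<Longrightarrow> tail C a = tail C b \<Longrightarrow> amap f a = amap f b \<Longrightarrow> a = b"
  using imm C.tail_in_verts[of a] unfolding immersion_def inj_on_def by (metis in_out_arcs_conv)

lemma P_verts: "(x, i) \<in> verts P \<longleftrightarrow> x \<in> verts G' \<and> i \<in> verts C \<and> vmap g x = vmap f i"
  and P_arcs: "(a, c) \<in> arcs P \<longleftrightarrow> a \<in> arcs G' \<and> c \<in> arcs C \<and> amap g a = amap f c"
  and P_tail: "tail P (a, c) = (tail G' a, tail C c)"
  and P_head: "head P (a, c) = (head G' a, head C c)"
  unfolding P_def fibre_product_def by (simp_all only: pre_digraph.simps mem_Collect_eq prod.case)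

lemma pr_eq: "(a, c) \<in> arcs P \<Longrightarrow> pr (a, c) = (r' a, rv c)"
  unfolding pr_def fibre_product_rev_def P_def by (simp only: prod.case if_True)

lemma pr_arc:
  assumes "b \<in> arcs P"
  shows "pr b \<in> arcs P" "pr (pr b) = b" "tail P (pr b) = head P b" "fst (pr b) = r' (fst b)"
proof -
  obtain a c where b: "b = (a, c)" by (cases b)
  have ac: "a \<in> arcs G'" "c \<in> arcs C" "amap g a = amap f c" using assms unfolding b P_arcs by blast+
  have eq: "pr b = (r' a, rv c)" using assms pr_eq unfolding b by blast
  show "pr b \<in> arcs P"
    unfolding eq P_arcs using ac G'.arev_in_arcs C.arev_in_arcs g_simps(3) amap_rv by metis
  then have "(r' a, rv c) \<in> arcs P" unfolding eq .
  then show "pr (pr b) = b" unfolding eq using pr_eq G'.arev_arev C.arev_arev b by metis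
  show "tail P (pr b) = head P b" unfolding eq unfolding b P_tail P_head using G'.tail_arev[OF ac(1)] C.tail_arev[OF ac(2)] by metis
  show "fst (pr b) = r' (fst b)" unfolding eq unfolding b by simp
qed

lemma Q_simps:
  "verts Q = (\<Union>K\<in>circles. verts K)" "arcs Q = (\<Union>K\<in>circles. arcs K)"
  "tail Q = tail P" "head Q = head P"
  unfolding Q_def circular_part_def circles_def pre_digraph.Union_def by (simp_all only: pre_digraph.simps)

lemma circleD:
  assumes "K \<in> circles"
  shows "circular K pr" "verts K \<subseteq> verts P" "arcs K \<subseteq> arcs P" "tail K = tail P" "head K = head P" "wf_digraph K"
proof -
  have sub: "subgraph K P" using assms unfolding circles_def components_def pre_digraph.max_subgraph_def by blast
  then show "verts K \<subseteq> verts P" "arcs K \<subseteq> arcs P" "tail K = tail P" "head K = head P" "wf_digraph K"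
    unfolding subgraph_def compatible_def by simp_all
  show "circular K pr" using assms unfolding circles_def by blast
qed

lemma Q_verts_P: "verts Q \<subseteq> verts P" and Q_arcs_P: "arcs Q \<subseteq> arcs P"
  using circleD(2,3) unfolding Q_simps by blast+

lemma wf_Q: "wf_digraph Q"
proof
  have "tail Q e \<in> verts Q \<and> head Q e \<in> verts Q" if e: "e \<in> arcs Q" for e
  proof -
    obtain K where K: "K \<in> circles" "e \<in> arcs K" using e unfolding Q_simps(2) by (elim UN_E)
    have "tail P e \<in> verts K" "head P e \<in> verts K"
      using wf_digraph.wellformed[OF circleD(6)[OF K(1)] K(2)] circleD(4,5)[OF K(1)] by simp_all
    then show ?thesis unfolding Q_simps using K(1) by (intro conjI UN_I)
  qed
  then show "e \<in> arcs Q \<Longrightarrow> tail Q e \<in> verts Q" "e \<in> arcs Q \<Longrightarrow> head Q e \<in> verts Q" for e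
    by simp_all
qed

sublocale Q: wf_digraph Q by (rule wf_Q)

lemma pr_Q: "b \<in> arcs Q \<Longrightarrow> pr b \<in> arcs Q"
proof -
  assume "b \<in> arcs Q"
  then obtain K where K: "K \<in> circles" "b \<in> arcs K" unfolding Q_simps by blast
  have "pr b \<in> arcs K" using circleD(1)[OF K(1)] K(2) by (rule circular_rev_closed)
  then show "pr b \<in> arcs Q" unfolding Q_simps(2) using K(1) by (rule UN_I[rotated])
qed

lemma finite_Q: "finite (verts Q)" "finite (arcs Q)"
proof -
  have "z \<in> verts G' \<times> verts C" if "z \<in> verts Q" for z
    using subsetD[OF Q_verts_P that] P_verts[of "fst z" "snd z"] unfolding mem_Times_iff prod.collapse by blast
  then have "verts Q \<subseteq> verts G' \<times> verts C" by (rule subsetI)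
  then show "finite (verts Q)" by (rule finite_subset) simp
  have "z \<in> arcs G' \<times> arcs C" if "z \<in> arcs Q" for z
    using subsetD[OF Q_arcs_P that] P_arcs[of "fst z" "snd z"] unfolding mem_Times_iff prod.collapse by blast
  then have "arcs Q \<subseteq> arcs G' \<times> arcs C" by (rule subsetI)
  then show "finite (arcs Q)" by (rule finite_subset) simp
qed

text \<open>
  A vertex of a circular component already has two arcs inside the component, and the immersion \<open>g\<close>
  allows at most one arc over each of the two arcs of \<open>C\<close> at \<open>i\<close>. So the projection to \<open>C\<close> is a
  covering on \<open>Q\<close>.
\<close>

lemma out_arcs_Q:
  assumes x: "(x, i) \<in> verts Q"
  shows "out_degree Q (x, i) = 2" "snd ` out_arcs Q (x, i) = out_arcs C i"
proof -
  let ?O = "out_arcs Q (x, i)"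
  have i: "i < n" using x Q_verts_P P_verts by auto
  have fin: "finite ?O" by (rule finite_subset[OF _ finite_Q(2)]) (rule subsetI, elim out_arcs_in_arcs)
  have O: "a \<in> arcs G' \<and> c \<in> arcs C \<and> amap g a = amap f c \<and> tail G' a = x \<and> tail C c = i" if "(a, c) \<in> ?O" for a c
  proof -
    have m: "(a, c) \<in> arcs Q" "tail Q (a, c) = (x, i)" using that unfolding in_out_arcs_conv by (rule conjunct1, rule conjunct2)
    then show ?thesis using subsetD[OF Q_arcs_P m(1)] unfolding P_arcs Q_simps(3) P_tail prod.inject by (intro conjI) (elim conjE, assumption)+
  qed
  have inj: "inj_on snd ?O"
  proof (rule inj_onI)
    fix b b' assume bb: "b \<in> ?O" "b' \<in> ?O" "snd b = snd b'"
    obtain a c a' where "b = (a, c)" "b' = (a', c)" using bb(3) by (metis prod.collapse)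
    then show "b = b'" using O[of a c] O[of a' c] bb(1,2) g_inj[of a a'] by simp
  qed
  have sub: "snd ` ?O \<subseteq> out_arcs C i"
  proof
    fix c assume "c \<in> snd ` ?O"
    then obtain a where "(a, c) \<in> ?O" by auto
    then show "c \<in> out_arcs C i" using O in_out_arcs_conv by metis
  qed
  have two: "card (out_arcs C i) = 2" unfolding out_arcs_circle[OF i] by simp
  then have finC: "finite (out_arcs C i)" by (metis card.infinite zero_neq_numeral)
  obtain K where K: "K \<in> circles" "(x, i) \<in> verts K" using x unfolding Q_simps by blast
  obtain b b' where b: "b \<in> arcs K" "b' \<in> arcs K" "b \<noteq> b'" "tail K b = (x, i)" "tail K b' = (x, i)"
    using circular_two_out[OF circleD(1)[OF K(1)] K(2)] by blast
  have "{b, b'} \<subseteq> ?O"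
    using b K(1) circleD(4)[OF K(1)] unfolding out_arcs_def Q_simps by auto
  then have "card {b, b'} \<le> card ?O" by (rule card_mono[OF fin])
  then have ge: "2 \<le> card ?O" using b(3) by simp
  have "card (snd ` ?O) = card ?O" by (rule card_image[OF inj])
  moreover have "card (snd ` ?O) \<le> 2" using card_mono[OF finC sub] two by simp
  ultimately show "out_degree Q (x, i) = 2" using ge unfolding out_degree_def by simp
  then show "snd ` ?O = out_arcs C i"
    using card_subset_eq[OF finC sub] two card_image[OF inj] unfolding out_degree_def by simp
qed

lemma scc_hits_circle:
  assumes c: "c \<in> Q.sccs_verts" and j: "j < n"
  shows "\<exists>b\<in>arcs Q. tail Q b \<in> c \<and> snd (tail Q b) = j"
proof -
  have cQ: "c \<subseteq> verts Q" using c by (rule Q.sccs_verts_subsets)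
  have up: "\<exists>b\<in>arcs Q. tail Q b = (x, i) \<and> snd (head Q b) = Suc i mod n \<and> head Q b \<in> c" if xi: "(x, i) \<in> c" for x i
  proof -
    have v: "(x, i) \<in> verts Q" using xi cQ by blast
    have i: "i < n" using v Q_verts_P P_verts by auto
    have "(i, True) \<in> snd ` out_arcs Q (x, i)" unfolding out_arcs_Q(2)[OF v] out_arcs_circle[OF i] by simp
    then obtain a where a: "(a, (i, True)) \<in> arcs Q" "tail Q (a, (i, True)) = (x, i)" by auto
    have aP: "(a, (i, True)) \<in> arcs P" using a(1) Q_arcs_P by blast
    let ?b = "(a, (i, True))"
    have h: "head Q ?b = (head G' a, Suc i mod n)" unfolding Q_simps P_head by simp
    have "(x, i) \<rightarrow>\<^bsub>Q\<^esub> head Q ?b" using Q.in_arcs_imp_in_arcs_ends[OF a(1)] a(2) by simp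
    moreover have "head Q ?b \<rightarrow>\<^bsub>Q\<^esub> (x, i)"
      using Q.in_arcs_imp_in_arcs_ends[OF pr_Q[OF a(1)]] pr_arc(2,3)[OF aP]
        pr_arc(3)[OF pr_arc(1)[OF aP]] a(2) unfolding Q_simps by simp
    ultimately have "(x, i) \<rightarrow>\<^sup>*\<^bsub>Q\<^esub> head Q ?b" "head Q ?b \<rightarrow>\<^sup>*\<^bsub>Q\<^esub> (x, i)" by simp_all
    then have "head Q ?b \<in> c" using c xi unfolding Q.sccs_verts_def by blast
    then show ?thesis using a h by (intro bexI[of _ ?b]) simp_all
  qed
  obtain x i where xi: "(x, i) \<in> c" using c by (fastforce simp: Q.sccs_verts_def)
  have "i < n" using xi cQ Q_verts_P P_verts by auto
  have all: "\<exists>y. (y, (i + k) mod n) \<in> c" for k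
  proof (induction k)
    case 0
    then show ?case using xi \<open>i < n\<close> by auto
  next
    case (Suc k)
    then obtain y where "(y, (i + k) mod n) \<in> c" by blast
    from up[OF this] obtain b where b: "snd (head Q b) = Suc ((i + k) mod n) mod n" "head Q b \<in> c" by blast
    have "(fst (head Q b), (i + Suc k) mod n) = head Q b" using b(1) by (simp add: prod_eq_iff mod_Suc_eq)
    then show ?case using b(2) by metis
  qed
  have "(i + (j + (n - i))) mod n = j" using \<open>i < n\<close> j by simp
  then obtain y where "(y, j) \<in> c" using all[of "j + (n - i)"] by auto
  then show ?thesis using up by force
qed

text \<open>
  The height of the second coordinate stacks the circular components. An arc over a highest vertex of
  \<open>C\<close> is topmost in its fibre, since no vertex at all is higher.
\<close>

theorem circular_components_bound:
  assumes con: "connected G'"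
  shows "2 * card (components Q) + 2 * card (verts G') \<le> card (arcs G') + 2"
proof -
  obtain h where h: "coherent h"
    and hinj: "\<And>i j. i < n \<Longrightarrow> j < n \<Longrightarrow> vmap f i = vmap f j \<Longrightarrow> h i = h j \<Longrightarrow> i = j"
    using stacking_exists[OF prim] by blast
  let ?p = "\<lparr>vmap = fst, amap = fst\<rparr> :: ('v \<times> nat, 'e \<times> nat \<times> bool, 'v, 'e) graph_map"
  let ?h = "\<lambda>x. h (snd x)"
  have QP: "a \<in> arcs G'" "c \<in> arcs C" "amap g a = amap f c" if "(a, c) \<in> arcs Q" for a c
    using that Q_arcs_P P_arcs[of a c] by blast+
  have less_n: "snd (tail Q b) < n" if "b \<in> arcs Q" for b
  proof -
    have "(fst (tail Q b), snd (tail Q b)) \<in> verts P" using Q.tail_in_verts[OF that] Q_verts_P by auto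
    then show ?thesis unfolding P_verts by simp
  qed
  interpret stacked_circles G' r' Q pr ?p ?h
  proof unfold_locales
    show "finite (verts G')" "finite (arcs G')" "finite (verts Q)" "finite (arcs Q)"
      using finite_Q by simp_all
    show "pr b \<in> arcs Q" if "b \<in> arcs Q" for b by (rule pr_Q[OF that])
    show "pr (pr b) = b" "tail Q (pr b) = head Q b" if "b \<in> arcs Q" for b
      using pr_arc(2,3)[of b] that Q_arcs_P unfolding Q_simps(3,4) by blast+
    show "immersion Q pr G' r' ?p"
      unfolding immersion_def graph_hom_def
    proof (intro conjI ballI)
      fix v assume "v \<in> verts Q"
      then show "vmap ?p v \<in> verts G'" using Q_verts_P P_verts[of "fst v" "snd v"] by auto
    next
      fix b assume b: "b \<in> arcs Q"
      obtain a c where ac: "b = (a, c)" by (cases b)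
      show "amap ?p b \<in> arcs G'" using QP(1)[of a c] b ac by simp
      show "tail G' (amap ?p b) = vmap ?p (tail Q b)" unfolding ac Q_simps P_tail by simp
      show "head G' (amap ?p b) = vmap ?p (head Q b)" unfolding ac Q_simps P_head by simp
      show "amap ?p (pr b) = r' (amap ?p b)" using pr_arc(4)[of b] b Q_arcs_P by auto
    next
      fix v assume "v \<in> verts Q"
      show "inj_on (amap ?p) (out_arcs Q v)"
      proof (rule inj_onI)
        fix b b' assume bb: "b \<in> out_arcs Q v" "b' \<in> out_arcs Q v" "amap ?p b = amap ?p b'"
        obtain a c c' where ac: "b = (a, c)" "b' = (a, c')" using bb(3) by (cases b, cases b') simp
        have m: "(a, c) \<in> arcs Q" "(a, c') \<in> arcs Q" and t: "tail P (a, c) = tail P (a, c')"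
          using bb(1,2) unfolding ac in_out_arcs_conv Q_simps(3) by simp_all
        have "tail C c = tail C c'" using t unfolding P_tail by simp
        then have "c = c'" using f_inj[OF QP(2)[OF m(1)] QP(2)[OF m(2)]] QP(3)[OF m(1)] QP(3)[OF m(2)] by simp
        then show "b = b'" using ac by simp
      qed
    qed
    show "out_degree Q x = 2" if "x \<in> verts Q" for x
      using out_arcs_Q(1)[of "fst x" "snd x"] that by simp
    show "x = y" if "x \<in> verts Q" "y \<in> verts Q" "vmap ?p x = vmap ?p y" "?h x = ?h y" for x y
    proof -
      have "(fst x, snd x) \<in> verts P" "(fst y, snd y) \<in> verts P" using that(1,2) Q_verts_P by auto
      then have "vmap f (snd x) = vmap f (snd y)" "snd x < n" "snd y < n"
        using that(3) unfolding P_verts by simp_all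
      then show ?thesis using hinj that(3,4) by (simp add: prod_eq_iff)
    qed
    show "?h (head Q b) < ?h (head Q b')"
      if bb: "b \<in> arcs Q" "b' \<in> arcs Q" "amap ?p b = amap ?p b'" "?h (tail Q b) < ?h (tail Q b')" for b b'
    proof -
      obtain a c c' where ac: "b = (a, c)" "b' = (a, c')" using bb(3) by (cases b, cases b') simp
      have m: "(a, c) \<in> arcs Q" "(a, c') \<in> arcs Q" using bb(1,2) ac by simp_all
      have "h (tail C c) < h (tail C c')" using bb(4) unfolding ac Q_simps P_tail by simp
      then have "h (head C c) < h (head C c')"
        using QP(3)[OF m(1)] QP(3)[OF m(2)] by (intro coherentD[OF h QP(2)[OF m(1)] QP(2)[OF m(2)]]) simp_all
      then show ?thesis unfolding ac Q_simps P_head by simp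
    qed
    have ne: "{..<n} \<noteq> {}" using n_pos by auto
    show "\<exists>b\<in>arcs Q. tail Q b \<in> c \<and> (\<forall>b'\<in>arcs Q. amap ?p b' = amap ?p b \<longrightarrow> ?h (tail Q b') \<le> ?h (tail Q b))"
      if c: "c \<in> Q.sccs_verts" for c
    proof -
      obtain j where j: "j \<in> {..<n}" "\<And>i. i \<in> {..<n} \<Longrightarrow> h i \<le> h j"
        by (rule ex_max_on_finite[of "{..<n}" h, OF _ ne]) blast+
      have "j < n" using j(1) by simp
      from scc_hits_circle[OF c this] obtain b where b: "b \<in> arcs Q" "tail Q b \<in> c" "snd (tail Q b) = j"
        by (elim bexE conjE)
      have "?h (tail Q b') \<le> ?h (tail Q b)" if "b' \<in> arcs Q" for b'
        using j(2)[of "snd (tail Q b')"] less_n[OF that] b(3) by simp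
      then show ?thesis using b(2) by (intro bexI[OF _ b(1)] conjI ballI impI)
    qed
    show "\<exists>b\<in>arcs Q. tail Q b \<in> c \<and> (\<forall>b'\<in>arcs Q. amap ?p b' = amap ?p b \<longrightarrow> ?h (tail Q b) \<le> ?h (tail Q b'))"
      if c: "c \<in> Q.sccs_verts" for c
    proof -
      obtain j where j: "j \<in> {..<n}" "\<And>i. i \<in> {..<n} \<Longrightarrow> - h i \<le> - h j"
        by (rule ex_max_on_finite[of "{..<n}" "\<lambda>i. - h i", OF _ ne]) blast+
      have "j < n" using j(1) by simp
      from scc_hits_circle[OF c this] obtain b where b: "b \<in> arcs Q" "tail Q b \<in> c" "snd (tail Q b) = j"
        by (elim bexE conjE)
      have "?h (tail Q b) \<le> ?h (tail Q b')" if "b' \<in> arcs Q" for b'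
        using j(2)[of "snd (tail Q b')"] less_n[OF that] b(3) by simp
      then show ?thesis using b(2) by (intro bexI[OF _ b(1)] conjI ballI impI)
    qed
  qed
  have "fin_digraph Q" using finite_Q by (rule Q.fin_digraphI)
  then have "finite Q.sccs" unfolding Q.sccs_conv_sccs_verts
    using fin_digraph.finite_sccs_verts by blast
  then have "card (components Q) \<le> card Q.sccs_verts"
    unfolding Q.card_sccs_verts using S.components_subset_sccs by (rule card_mono)
  then show ?thesis using betti_bound[OF con] by linarith
qed

end

section \<open>The bound by the rank\<close>

theorem mainTheorem2:
  fixes \<Gamma>' :: "('v, 'e) pre_digraph" and \<iota>' :: "'e \<Rightarrow> 'e"
    and \<Gamma> :: "('w, 'f) pre_digraph" and \<iota> :: "'f \<Rightarrow> 'f"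
    and \<rho> :: "('v, 'e, 'w, 'f) graph_map"
    and n :: nat and \<Lambda> :: "(nat, nat \<times> bool, 'w, 'f) graph_map"
    and v :: 'v
  assumes "core_graph \<Gamma>' \<iota>'" and "core_graph \<Gamma> \<iota>"
    and "immersion \<Gamma>' \<iota>' \<Gamma> \<iota> \<rho>"
    and "n \<ge> 1" and "primitive_loop n \<Gamma> \<iota> \<Lambda>"
    and "v \<in> verts \<Gamma>'"
  shows "enat (card (components
           (circular_part (fibre_product \<Gamma>' (circle_graph n) \<rho> \<Lambda>)
              (fibre_product_rev \<Gamma>' \<iota>' (circle_graph n) (circle_rev n) \<rho> \<Lambda>))))
         \<le> group_rank (fundamental_group \<Gamma>' \<iota>' v)"
proof -
  interpret G: bidirected_digraph \<Gamma> \<iota> using assms(2) by (simp add: core_graph_def)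
  interpret G': bidirected_digraph \<Gamma>' \<iota>' using assms(1) by (simp add: core_graph_def)
  interpret G': fin_digraph \<Gamma>' using assms(1) by (simp add: core_graph_def)
  have con: "connected \<Gamma>'" using assms(1) by (simp add: core_graph_def)
  interpret lifted_loop \<Gamma> \<iota> n \<Lambda> \<Gamma>' \<iota>' \<rho>
    using assms(3-5) by unfold_locales (simp_all add: primitive_loop_def)
  show ?thesis
    using circular_components_bound[OF con] unfolding Q_def P_def pr_def by (rule G'.rank_bound[OF G'.finite_verts G'.finite_arcs con assms(6)])
qed

end
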